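(* Let $n,r,m,p,N$ be positive integers with $r\le n$, and let $t_0<t_1<\dots<t_{N-1}$ be sample times. Fix the data $\mathbf{x}(t_0)\in\mathbb{R}^n$, $\mathbf{y}(t_0),\dots,\mathbf{y}(t_{N-1})\in\mathbb{R}^p$, a continuous input $\mathbf{u}:[t_0,t_{N-1}]\to\mathbb{R}^m$, and a continuously differentiable output map $\mathbf{h}:\mathbb{R}^n\to\mathbb{R}^p$. Consider parameters $\Phi,\Psi\in\mathbb{R}^{n\times r}$ with $\Psi^\intercal\Phi$ invertible, $\mathbf{A}_r\in\mathbb{R}^{r\times r}$, $\mathbf{H}_r\in\mathbb{R}^{r\times r\times r}$, $\mathbf{B}_r\in\mathbb{R}^{r\times m}$, such that the solution $\hat{\mathbf{z}}$ of $$\frac{d\hat{\mathbf{z}}}{dt}=\overline{\mathbf{f}}_r(\hat{\mathbf{z}},\mathbf{u}):=\mathbf{A}_r\hat{\mathbf{z}}+\mathbf{H}_r:\hat{\mathbf{z}}\hat{\mathbf{z}}^\intercal+\mathbf{B}_r\mathbf{u},\qquad \hat{\mathbf{z}}(t_0)=\Psi^\intercal\mathbf{x}(t_0),$$ exists on $[t_0,t_{N-1}]$. Let $$J=\sum_{i=0}^{N-1}\big\lVert \mathbf{y}(t_i)-\mathbf{h}\big(\Phi(\Psi^\intercal\Phi)^{-1}\hat{\mathbf{z}}(t_i)\big)\big\rVert^2$$ be the cost function, and write the minimization of $J$ subject to the constraints $\frac{d\hat{\mathbf{z}}}{dt}=\mathbf{A}_r\hat{\mathbf{z}}+\mathbf{H}_r:\hat{\mathbf{z}}\hat{\mathbf{z}}^\intercal+\mathbf{B}_r\mathbf{u}$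 and $\hat{\mathbf{z}}(t_0)=\Psi^\intercal\mathbf{x}(t_0)$ as an unconstrained problem with Lagrangian $$L=\sum_{i=0}^{N-1}\Big\{\big\lVert \mathbf{y}(t_i)-\mathbf{h}\big(\Phi(\Psi^\intercal\Phi)^{-1}\hat{\mathbf{z}}(t_i)\big)\big\rVert^2+\int_{t_0}^{t_i}\boldsymbol{\lambda}_i^\intercal\Big(\frac{d\hat{\mathbf{z}}}{dt}-\mathbf{A}_r\hat{\mathbf{z}}-\mathbf{H}_r:\hat{\mathbf{z}}\hat{\mathbf{z}}^\intercal-\mathbf{B}_r\mathbf{u}\Big)dt+\boldsymbol{\lambda}_i(t_0)^\intercal\big(\hat{\mathbf{z}}(t_0)-\Psi^\intercal\mathbf{x}(t_0)\big)\Big\},$$ where $\boldsymbol{\lambda}_i(t)\in\mathbb{R}^r$, $t\in[t_0,t_i]$, is the $i$-th Lagrange multiplier. Define $\mathbf{e}(t_i):=\mathbf{y}(t_i)-\mathbf{h}\big(\Phi(\Psi^\intercal\Phi)^{-1}\hat{\mathbf{z}}(t_i)\big)$ and let $\mathbf{C}(t_i)\in\mathbb{R}^{p\times n}$ be the Jacobian $\mathbf{C}_{j,k}=\partial\mathbf{h}_j/\partial\mathbf{x}_k$ evaluated at $\Phi(\Psi^\intercal\Phi)^{-1}\hat{\mathbf{z}}(t_i)$. Then the Euclidean gradients of the Lagrangian (taken along the solution $\hat{\mathbf{z}}$ determined by the parameters, so that they are the gradients of the cost function $J$) with respect to each of the parameters are $$\nabla_{\Phi}L=-2\sum_{i=0}^{N-1}\big(\mathbf{I}-\Psi(\Phi^\intercal\Psi)^{-1}\Phi^\intercal\big)\mathbf{C}(t_i)^\intercal\mathbf{e}(t_i)\hat{\mathbf{z}}(t_i)^\intercal(\Phi^\intercal\Psi)^{-1},$$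 $$\nabla_{\Psi}L=\sum_{i=0}^{N-1}\Big(2\Phi(\Psi^\intercal\Phi)^{-1}\hat{\mathbf{z}}(t_i)\mathbf{e}(t_i)^\intercal\mathbf{C}(t_i)\Phi(\Psi^\intercal\Phi)^{-1}-\mathbf{x}(t_0)\boldsymbol{\lambda}_i(t_0)^\intercal\Big),$$ $$\nabla_{\mathbf{A}_r}L=-\sum_{i=0}^{N-1}\int_{t_0}^{t_i}\boldsymbol{\lambda}_i\hat{\mathbf{z}}^\intercal\,dt,\qquad \nabla_{\mathbf{H}_r}L=-\sum_{i=0}^{N-1}\int_{t_0}^{t_i}\boldsymbol{\lambda}_i\otimes(\hat{\mathbf{z}}\hat{\mathbf{z}}^\intercal)\,dt,\qquad \nabla_{\mathbf{B}_r}L=-\sum_{i=0}^{N-1}\int_{t_0}^{t_i}\boldsymbol{\lambda}_i\mathbf{u}^\intercal\,dt,$$ where the Lagrange multiplier $\boldsymbol{\lambda}_i$ satisfies the reduced-order adjoint equation $$-\frac{d\boldsymbol{\lambda}_i}{dt}=\big[\partial_{\hat{\mathbf{z}}}\overline{\mathbf{f}}_r(\hat{\mathbf{z}},\mathbf{u})\big]^\intercal\boldsymbol{\lambda}_i,\quad t\in[t_0,t_i],\qquad \boldsymbol{\lambda}_i(t_i)=2(\Phi^\intercal\Psi)^{-1}\Phi^\intercal\mathbf{C}(t_i)^\intercal\mathbf{e}(t_i).$$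
   Context: Norms are Euclidean. For a third-order tensor $\mathbf{H}\in\mathbb{R}^{r\times r\times r}$ (no symmetry assumed) and $\mathbf{z}\in\mathbb{R}^r$, $\mathbf{H}:\mathbf{z}\mathbf{z}^\intercal\in\mathbb{R}^r$ has components $(\mathbf{H}:\mathbf{z}\mathbf{z}^\intercal)_a=\sum_{b,c}\mathbf{H}_{abc}z_bz_c$; for $\boldsymbol{\lambda}\in\mathbb{R}^r$, $\boldsymbol{\lambda}\otimes(\mathbf{z}\mathbf{z}^\intercal)$ is the tensor with entries $\lambda_az_bz_c$. $\partial_{\hat{\mathbf{z}}}\overline{\mathbf{f}}_r$ denotes the $r\times r$ Jacobian matrix of $\overline{\mathbf{f}}_r$ with respect to its first argument. The Euclidean gradient with respect to a matrix or tensor parameter is the one representing the directional derivative through the standard entrywise inner product (for matrices, $\langle X,Y\rangle=\mathrm{Tr}(X^\intercal Y)$); all parameters, including $\Phi$ and $\Psi$, are regarded as varying in the ambient linear spaces ($\mathbb{R}^{n\times r}$ for $\Phi$ and $\Psi$, on the open set where $\Psi^\intercal\Phi$ is invertible), the other parameters being held fixed. The solution $\hat{\mathbf{z}}$ depends on $\Psi,\mathbf{A}_r,\mathbf{H}_r,\mathbf{B}_r$ through the reduced-order dynamics and initial condition; $\mathbf{x}(t_0)$, $\mathbf{y}(t_i)$ and $\mathbf{u}$ do not depend on the parameters. When $i=0$ the integrals are zero and $\boldsymbol{\lambda}_0$ is given by its terminal value at $t_0$. *)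

theory Defs
  imports "HOL-Analysis.Analysis"
begin

text \<open>The matrix \<open>a b\<^sup>T\<close>.\<close>
definition outer :: "real^'a \<Rightarrow> real^'b \<Rightarrow> real^'b^'a" where
  "outer a b = (\<chi> i j. a $ i * b $ j)"

text \<open>The contraction \<open>H : z z\<^sup>T\<close> and the tensor \<open>l \<otimes> (z z\<^sup>T)\<close>.
  The entry \<open>H\<^sub>a\<^sub>b\<^sub>c\<close> is \<open>H $ a $ b $ c\<close>, and the inner product that
  \<open>GDERIV\<close> uses on \<open>real^'r^'r^'r\<close> is the entrywise one.\<close>
definition tensor_quad :: "real^'r^'r^'r \<Rightarrow> real^'r \<Rightarrow> real^'r" where
  "tensor_quad H z = (\<chi> a. \<Sum>b\<in>UNIV. \<Sum>c\<in>UNIV. H $ a $ b $ c * z $ b * z $ c)"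

definition tensor_outer :: "real^'r \<Rightarrow> real^'r \<Rightarrow> real^'r^'r^'r" where
  "tensor_outer l z = (\<chi> a b c. l $ a * z $ b * z $ c)"

definition rom_rhs ::
  "real^'r^'r \<Rightarrow> real^'r^'r^'r \<Rightarrow> real^'m^'r \<Rightarrow> real^'r \<Rightarrow> real^'m \<Rightarrow> real^'r" where
  "rom_rhs A H B z v = A *v z + tensor_quad H z + B *v v"

text \<open>Sample times are \<open>t 0, \<dots>, t (N - 1)\<close>. The derivatives at the two ends of the time
  interval are one-sided; if \<open>N = 1\<close> only the initial condition remains.\<close>
definition rom_solution ::
  "(nat \<Rightarrow> real) \<Rightarrow> nat \<Rightarrow> real^'n \<Rightarrow> (real \<Rightarrow> real^'m) \<Rightarrow> real^'r^'n \<Rightarrow>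
   real^'r^'r \<Rightarrow> real^'r^'r^'r \<Rightarrow> real^'m^'r \<Rightarrow> (real \<Rightarrow> real^'r) \<Rightarrow> bool" where
  "rom_solution t N x0 u \<Psi> A H B z \<longleftrightarrow>
     z (t 0) = transpose \<Psi> *v x0 \<and>
     (\<forall>s\<in>{t 0..t (N - 1)}.
        (z has_vector_derivative rom_rhs A H B (z s) (u s)) (at s within {t 0..t (N - 1)}))"

text \<open>The solution determined by the parameters. Its values on \<open>{t 0..t (N - 1)}\<close> are unique
  whenever a solution exists there; only the irrelevant values outside depend on the choice.\<close>
definition rom_flow ::
  "(nat \<Rightarrow> real) \<Rightarrow> nat \<Rightarrow> real^'n \<Rightarrow> (real \<Rightarrow> real^'m) \<Rightarrow> real^'r^'n \<Rightarrow>
   real^'r^'r \<Rightarrow> real^'r^'r^'r \<Rightarrow> real^'m^'r \<Rightarrow> real \<Rightarrow> real^'r" where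
  "rom_flow t N x0 u \<Psi> A H B = (SOME z. rom_solution t N x0 u \<Psi> A H B z)"

definition lift :: "real^'r^'n \<Rightarrow> real^'r^'n \<Rightarrow> real^'r \<Rightarrow> real^'n" where
  "lift \<Phi> \<Psi> z = (\<Phi> ** matrix_inv (transpose \<Psi> ** \<Phi>)) *v z"

definition output_error ::
  "(nat \<Rightarrow> real) \<Rightarrow> (nat \<Rightarrow> real^'p) \<Rightarrow> (real^'n \<Rightarrow> real^'p) \<Rightarrow>
   real^'r^'n \<Rightarrow> real^'r^'n \<Rightarrow> (real \<Rightarrow> real^'r) \<Rightarrow> nat \<Rightarrow> real^'p" where
  "output_error t y h \<Phi> \<Psi> z i = y i - h (lift \<Phi> \<Psi> (z (t i)))"

definition output_jacobian ::
  "(nat \<Rightarrow> real) \<Rightarrow> (real^'n \<Rightarrow> real^'p) \<Rightarrow>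
   real^'r^'n \<Rightarrow> real^'r^'n \<Rightarrow> (real \<Rightarrow> real^'r) \<Rightarrow> nat \<Rightarrow> real^'n^'p" where
  "output_jacobian t h \<Phi> \<Psi> z i = jacobian h (at (lift \<Phi> \<Psi> (z (t i))))"

definition cost ::
  "(nat \<Rightarrow> real) \<Rightarrow> nat \<Rightarrow> (nat \<Rightarrow> real^'p) \<Rightarrow> (real^'n \<Rightarrow> real^'p) \<Rightarrow>
   real^'r^'n \<Rightarrow> real^'r^'n \<Rightarrow> (real \<Rightarrow> real^'r) \<Rightarrow> real" where
  "cost t N y h \<Phi> \<Psi> z = (\<Sum>i<N. (norm (output_error t y h \<Phi> \<Psi> z i))\<^sup>2)"

definition lagrangian ::
  "(nat \<Rightarrow> real) \<Rightarrow> nat \<Rightarrow> real^'n \<Rightarrow> (nat \<Rightarrow> real^'p) \<Rightarrow> (real \<Rightarrow> real^'m) \<Rightarrow>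
   (real^'n \<Rightarrow> real^'p) \<Rightarrow> real^'r^'n \<Rightarrow> real^'r^'n \<Rightarrow>
   real^'r^'r \<Rightarrow> real^'r^'r^'r \<Rightarrow> real^'m^'r \<Rightarrow>
   (real \<Rightarrow> real^'r) \<Rightarrow> (nat \<Rightarrow> real \<Rightarrow> real^'r) \<Rightarrow> real" where
  "lagrangian t N x0 y u h \<Phi> \<Psi> A H B z lam =
     (\<Sum>i<N. (norm (output_error t y h \<Phi> \<Psi> z i))\<^sup>2
        + integral {t 0..t i} (\<lambda>s. lam i s \<bullet>
            (vector_derivative z (at s within {t 0..t (N - 1)})
              - A *v z s - tensor_quad H (z s) - B *v u s))
        + lam i (t 0) \<bullet> (z (t 0) - transpose \<Psi> *v x0))"

text \<open>Cost and Lagrangian as functions of the parameters, along the solution they determine;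
  the multipliers are held fixed.\<close>
definition reduced_cost ::
  "(nat \<Rightarrow> real) \<Rightarrow> nat \<Rightarrow> real^'n \<Rightarrow> (nat \<Rightarrow> real^'p) \<Rightarrow> (real \<Rightarrow> real^'m) \<Rightarrow>
   (real^'n \<Rightarrow> real^'p) \<Rightarrow> real^'r^'n \<Rightarrow> real^'r^'n \<Rightarrow>
   real^'r^'r \<Rightarrow> real^'r^'r^'r \<Rightarrow> real^'m^'r \<Rightarrow> real" where
  "reduced_cost t N x0 y u h \<Phi> \<Psi> A H B =
     cost t N y h \<Phi> \<Psi> (rom_flow t N x0 u \<Psi> A H B)"

definition reduced_lagrangian ::
  "(nat \<Rightarrow> real) \<Rightarrow> nat \<Rightarrow> real^'n \<Rightarrow> (nat \<Rightarrow> real^'p) \<Rightarrow> (real \<Rightarrow> real^'m) \<Rightarrow>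
   (real^'n \<Rightarrow> real^'p) \<Rightarrow> (nat \<Rightarrow> real \<Rightarrow> real^'r) \<Rightarrow> real^'r^'n \<Rightarrow> real^'r^'n \<Rightarrow>
   real^'r^'r \<Rightarrow> real^'r^'r^'r \<Rightarrow> real^'m^'r \<Rightarrow> real" where
  "reduced_lagrangian t N x0 y u h lam \<Phi> \<Psi> A H B =
     lagrangian t N x0 y u h \<Phi> \<Psi> A H B (rom_flow t N x0 u \<Psi> A H B) lam"

definition adjoint_solution ::
  "(nat \<Rightarrow> real) \<Rightarrow> nat \<Rightarrow> (nat \<Rightarrow> real^'p) \<Rightarrow> (real \<Rightarrow> real^'m) \<Rightarrow>
   (real^'n \<Rightarrow> real^'p) \<Rightarrow> real^'r^'n \<Rightarrow> real^'r^'n \<Rightarrow>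
   real^'r^'r \<Rightarrow> real^'r^'r^'r \<Rightarrow> real^'m^'r \<Rightarrow>
   (real \<Rightarrow> real^'r) \<Rightarrow> (nat \<Rightarrow> real \<Rightarrow> real^'r) \<Rightarrow> bool" where
  "adjoint_solution t N y u h \<Phi> \<Psi> A H B z lam \<longleftrightarrow>
     (\<forall>i<N.
        (\<forall>s\<in>{t 0..t i}. (lam i has_vector_derivative
            - (transpose (jacobian (\<lambda>w. rom_rhs A H B w (u s)) (at (z s))) *v lam i s))
            (at s within {t 0..t i})) \<and>
        lam i (t i) =
          2 *\<^sub>R ((matrix_inv (transpose \<Phi> ** \<Psi>) ** transpose \<Phi>
            ** transpose (output_jacobian t h \<Phi> \<Psi> z i)) *v output_error t y h \<Phi> \<Psi> z i))"

end

theory Submission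
  imports Defs
begin

text \<open>For perturbed parameters let \<open>w\<close> be the perturbed trajectory and \<open>d = w - z\<close>.
  Truncating the vector field outside a tube around \<open>z\<close> makes it globally Lipschitz; its solution
  satisfies \<open>\<bar>d\<bar> \<le> K \<bar>\<Delta>\<bar>\<close> by a Gronwall estimate, so for small \<open>\<Delta>\<close> it never leaves
  the tube and solves the original equation. The adjoint equation cancels the linear part of the dynamics
  of \<open>d\<close>, whence \<open>\<lambda> \<bullet> d\<close> at the sample time equals
  \<open>\<lambda>(t\<^sub>0) \<bullet> \<Delta>\<Psi>\<^sup>T x\<^sub>0 + \<integral> \<lambda> \<bullet> (\<Delta>A z + \<Delta>H : z z\<^sup>T + \<Delta>B u)\<close> up to a
  remainder quadratic in \<open>\<Delta>\<close>; no variational equation is needed. The terminal value of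
  \<open>\<lambda>\<close> is minus the gradient of the squared output error in the state, so the chain rule
  through the lifting map gives the gradients of the cost, and the Lagrangian coincides with the cost
  wherever a solution exists.\<close>

section \<open>Lipschitz differential equations\<close>

text \<open>A Gronwall estimate for the squared norm, which stays differentiable where
  \<open>v\<close> vanishes. The forcing \<open>d\<close> is absorbed by 2xy \<le> x^2 + y^2, which
  costs the extra 1 in the rate \<open>2 * L + 1\<close>.\<close>

lemma ode_energy_bound:
  fixes v :: "real \<Rightarrow> 'a::real_inner"
  assumes deriv: "\<And>s. s \<in> {a..b} \<Longrightarrow> (v has_vector_derivative v' s) (at s within {a..b})"
    and bound: "\<And>s. s \<in> {a..b} \<Longrightarrow> norm (v' s) \<le> L * norm (v s) + d"
    and "0 \<le> L" and s: "s \<in> {a..b}"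
  shows "(norm (v s))\<^sup>2 \<le> exp ((2 * L + 1) * (s - a)) * ((norm (v a))\<^sup>2 + d\<^sup>2 * (s - a))"
proof -
  define K where "K = 2 * L + 1"
  \<comment> \<open>\<open>E\<close> is nonincreasing: the exponential weight absorbs the growth at
    rate \<open>K\<close>, and the linear term absorbs the forcing, whose weight is at most 1 to the
    right of \<open>a\<close>.\<close>
  define E where "E r = exp (- (K * (r - a))) * (v r \<bullet> v r) - d\<^sup>2 * (r - a)" for r
  define E' where "E' r = exp (- (K * (r - a))) * (2 * (v r \<bullet> v' r) - K * (v r \<bullet> v r)) - d\<^sup>2" for r
  have E: "(E has_real_derivative E' r) (at r within {a..b})" if "r \<in> {a..b}" for r
  proof -
    have "((\<lambda>r. v r \<bullet> v r) has_real_derivative 2 * (v r \<bullet> v' r)) (at r within {a..b})"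
      using has_derivative_inner[OF deriv[OF that, unfolded has_vector_derivative_def]
        deriv[OF that, unfolded has_vector_derivative_def]]
      by (rule has_derivative_imp_has_field_derivative) (simp add: inner_commute)
    then show ?thesis
      unfolding E_def E'_def
      by (auto intro!: derivative_eq_intros simp: algebra_simps)
  qed
  have E'_le: "E' r \<le> 0" if "r \<in> {a..b}" for r
  proof -
    have "2 * (v r \<bullet> v' r) \<le> 2 * (norm (v r) * norm (v' r))"
      using norm_cauchy_schwarz[of "v r" "v' r"] by simp
    also have "\<dots> \<le> 2 * (norm (v r) * (L * norm (v r) + d))"
      using bound[OF that] by (simp add: mult_left_mono)
    also have "\<dots> \<le> K * (norm (v r))\<^sup>2 + d\<^sup>2"
      using sum_squares_bound[of "norm (v r)" d] unfolding K_def
      by (simp add: power2_eq_square algebra_simps)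
    finally have "2 * (v r \<bullet> v' r) - K * (v r \<bullet> v r) \<le> d\<^sup>2"
      by (simp add: power2_norm_eq_inner)
    then have "exp (- (K * (r - a))) * (2 * (v r \<bullet> v' r) - K * (v r \<bullet> v r))
        \<le> exp (- (K * (r - a))) * d\<^sup>2"
      by (rule mult_left_mono) simp
    also have "\<dots> \<le> 1 * d\<^sup>2"
      using that \<open>0 \<le> L\<close> by (intro mult_right_mono) (auto simp: K_def)
    finally show ?thesis by (simp add: E'_def)
  qed
  have "\<exists>r\<in>{a..s}. E s - E a = (*) (E' r) (s - a)"
    using s by (intro mvt_very_simple)
      (auto intro!: has_derivative_subset[OF E[unfolded has_field_derivative_def]])
  then have "E s \<le> E a"
    using E'_le s by (fastforce dest: mult_nonpos_nonneg[of "E' _" "s - a"])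
  then have "exp (- (K * (s - a))) * (norm (v s))\<^sup>2 \<le> (norm (v a))\<^sup>2 + d\<^sup>2 * (s - a)"
    by (simp add: E_def power2_norm_eq_inner)
  then have "exp (K * (s - a)) * (exp (- (K * (s - a))) * (norm (v s))\<^sup>2)
      \<le> exp (K * (s - a)) * ((norm (v a))\<^sup>2 + d\<^sup>2 * (s - a))"
    by (rule mult_left_mono) simp
  then show ?thesis by (simp add: K_def flip: exp_add mult.assoc)
qed

text \<open>Picard's fixed point argument in an exponentially weighted sup norm. The weight makes
  the integral operator a contraction on the whole interval at once, so no short solutions have to
  be glued together.\<close>

lemma ode_lipschitz_solution_exists:
  fixes g :: "real \<Rightarrow> 'a::euclidean_space \<Rightarrow> 'a"
  assumes "a \<le> b"
    and cont: "continuous_on ({a..b} \<times> UNIV) (\<lambda>(s, x). g s x)"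
    and lip: "\<And>s. s \<in> {a..b} \<Longrightarrow> L-lipschitz_on UNIV (g s)"
  obtains v where "v a = v0"
    and "\<And>s. s \<in> {a..b} \<Longrightarrow> (v has_vector_derivative g s (v s)) (at s within {a..b})"
proof -
  have "0 \<le> L" using lip[of a] \<open>a \<le> b\<close> by (auto intro: lipschitz_on_nonneg)
  \<comment> \<open>This rate is positive even for \<open>L = 0\<close> and gives L / K \<le> 1/2,
    the contraction factor below.\<close>
  define K where "K = 2 * L + 1"
  have "0 < K" using \<open>0 \<le> L\<close> by (simp add: K_def)
  \<comment> \<open>The unknown \<open>w\<close> is the trajectory divided by exp (K * (r - a)), so
    the plain sup distance of bounded continuous functions is the weighted distance of trajectories.
    \<open>G\<close> restores the weight before applying \<open>g\<close>.\<close>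
  define G where "G w r = g r (exp (K * (r - a)) *\<^sub>R apply_bcontfun w r)" for w r
  define V where "V w s = v0 + integral {a..s} (G w)" for w s
  have G_cont: "continuous_on {a..b} (G w)" for w
    unfolding G_def
    by (rule continuous_on_compose2[OF cont, of "{a..b}" "\<lambda>r. (r, exp (K * (r - a)) *\<^sub>R apply_bcontfun w r)", simplified])
      (auto intro!: continuous_intros)
  have G_int: "G w integrable_on {a..s}" if "s \<in> {a..b}" for w s
    using that by (auto intro!: integrable_continuous_real continuous_on_subset[OF G_cont])
  have V_deriv: "(V w has_vector_derivative G w s) (at s within {a..b})" if "s \<in> {a..b}" for w s
    unfolding V_def using integral_has_vector_derivative[OF G_cont that, of w]
    by (auto intro!: derivative_eq_intros)
  have V_cont: "continuous_on {a..b} (V w)" for w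
    by (meson V_deriv has_vector_derivative_continuous continuous_on_eq_continuous_within)
  \<comment> \<open>Bounded continuous functions live on the whole line, so the weighted iterate is
    extended by constants outside the interval through \<open>clamp\<close>.\<close>
  have "\<exists>x. \<forall>s. apply_bcontfun x s
      = exp (- (K * (clamp a b s - a))) *\<^sub>R V w (clamp a b s)" for w
  proof -
    have c: "continuous_on (cbox a b) (\<lambda>s. exp (- (K * (s - a))) *\<^sub>R V w s)"
      using V_cont[of w] by (auto intro!: continuous_intros)
    show ?thesis by (rule continuous_on_cbox_bcontfunE[OF c]) auto
  qed
  then obtain P where P: "\<And>w s. apply_bcontfun (P w) s
      = exp (- (K * (clamp a b s - a))) *\<^sub>R V w (clamp a b s)" by metis
  have V_dist: "norm (V w1 s - V w2 s) \<le> 1/2 * dist w1 w2 * exp (K * (s - a))"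
    if s: "s \<in> {a..b}" for w1 w2 s
  proof -
    have ex: "((\<lambda>r. L * dist w1 w2 * exp (K * (r - a))) has_integral
        L * dist w1 w2 / K * exp (K * (s - a)) - L * dist w1 w2 / K * exp (K * (a - a))) {a..s}"
      using s \<open>0 < K\<close> by (intro fundamental_theorem_of_calculus)
        (auto intro!: derivative_eq_intros simp flip: has_real_derivative_iff_has_vector_derivative)
    have "norm (V w1 s - V w2 s) = norm (integral {a..s} (\<lambda>r. G w1 r - G w2 r))"
      using s by (simp add: V_def integral_diff G_int)
    also have "\<dots> \<le> integral {a..s} (\<lambda>r. L * dist w1 w2 * exp (K * (r - a)))"
    proof (rule integral_norm_bound_integral)
      fix r assume "r \<in> {a..s}"
      then have r: "r \<in> {a..b}" using s by auto
      have "norm (G w1 r - G w2 r) \<le> L * dist (exp (K * (r - a)) *\<^sub>R apply_bcontfun w1 r) (exp (K * (r - a)) *\<^sub>R apply_bcontfun w2 r)"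
        unfolding G_def dist_norm[symmetric] using lip[OF r] by (rule lipschitz_onD) auto
      also have "\<dots> = L * (exp (K * (r - a)) * dist (apply_bcontfun w1 r) (apply_bcontfun w2 r))"
        by (simp add: dist_norm flip: scaleR_diff_right)
      also have "\<dots> \<le> L * (exp (K * (r - a)) * dist w1 w2)"
        using \<open>0 \<le> L\<close> by (intro mult_left_mono dist_bounded) auto
      finally show "norm (G w1 r - G w2 r) \<le> L * dist w1 w2 * exp (K * (r - a))"
        by (simp add: mult_ac)
    qed (use s ex in \<open>auto intro!: integrable_diff G_int\<close>)
    also have "\<dots> \<le> L * dist w1 w2 / K * exp (K * (s - a))"
      using \<open>0 \<le> L\<close> \<open>0 < K\<close> by (simp only: integral_unique[OF ex]) simp
    also have "\<dots> \<le> 1/2 * dist w1 w2 * exp (K * (s - a))"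
    proof (rule mult_right_mono)
      have "L / K * dist w1 w2 \<le> 1/2 * dist w1 w2"
        using \<open>0 < K\<close> by (intro mult_right_mono) (auto simp: K_def field_simps)
      then show "L * dist w1 w2 / K \<le> 1/2 * dist w1 w2" by simp
    qed simp
    finally show ?thesis .
  qed
  have "\<exists>!w. P w = w"
  proof (rule banach_fix_type[of "1/2"]; (intro allI)?)
    fix w1 w2
    show "dist (P w1) (P w2) \<le> 1/2 * dist w1 w2"
    proof (rule dist_bound)
      fix s
      define c where "c = clamp a b s"
      have c: "c \<in> {a..b}" using clamp_in_interval[of a b s] \<open>a \<le> b\<close> by (simp add: c_def)
      have "dist (apply_bcontfun (P w1) s) (apply_bcontfun (P w2) s)
          = exp (- (K * (c - a))) * norm (V w1 c - V w2 c)"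
        by (simp add: P flip: c_def) (simp add: dist_norm flip: scaleR_diff_right)
      also have "\<dots> \<le> exp (- (K * (c - a))) * (1/2 * dist w1 w2 * exp (K * (c - a)))"
        by (intro mult_left_mono V_dist c) simp
      also have "\<dots> = 1/2 * dist w1 w2" by (simp add: exp_minus)
      finally show "dist (apply_bcontfun (P w1) s) (apply_bcontfun (P w2) s) \<le> 1/2 * dist w1 w2" .
    qed
  qed auto
  then obtain w where w: "P w = w" by blast
  show ?thesis
  proof
    show "V w a = v0" by (simp add: V_def)
    fix s assume s: "s \<in> {a..b}"
    \<comment> \<open>Undoing the weight at the fixed point shows that \<open>V w\<close> is its own
      Picard iterate, so the derivative of \<open>V w\<close> is \<open>g\<close> along
      \<open>V w\<close>.\<close>
    have "apply_bcontfun w s = exp (- (K * (s - a))) *\<^sub>R V w s"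
      using P[of w s] s by (simp add: w)
    then have "exp (K * (s - a)) *\<^sub>R apply_bcontfun w s = V w s"
      by (simp flip: exp_add)
    then have "G w s = g s (V w s)" by (simp add: G_def)
    then show "(V w has_vector_derivative g s (V w s)) (at s within {a..b})"
      using V_deriv[OF s, of w] by simp
  qed
qed

text \<open>Time reversal s -> -s turns the terminal condition into an initial one. It serves the
  adjoint equation, which runs backwards from the sample time.\<close>

lemma ode_lipschitz_terminal_solution_exists:
  fixes g :: "real \<Rightarrow> 'a::euclidean_space \<Rightarrow> 'a"
  assumes "a \<le> b"
    and cont: "continuous_on ({a..b} \<times> UNIV) (\<lambda>(s, x). g s x)"
    and lip: "\<And>s. s \<in> {a..b} \<Longrightarrow> L-lipschitz_on UNIV (g s)"
  obtains v where "v b = v0"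
    and "\<And>s. s \<in> {a..b} \<Longrightarrow> (v has_vector_derivative g s (v s)) (at s within {a..b})"
proof -
  have "continuous_on ({-b..-a} \<times> UNIV) (\<lambda>(s, x). - g (- s) x)"
    using continuous_on_compose2[OF cont, of "{-b..-a} \<times> UNIV" "\<lambda>p. (- fst p, snd p)"]
    by (simp add: split_beta continuous_intros image_subset_iff)
  moreover have "L-lipschitz_on UNIV (\<lambda>x. - g (- s) x)" if "s \<in> {-b..-a}" for s
    using lip[of "- s"] that by (auto intro!: lipschitz_on_minus)
  ultimately obtain v where v: "v (- b) = v0"
    "\<And>s. s \<in> {-b..-a} \<Longrightarrow> (v has_vector_derivative - g (- s) (v s)) (at s within {-b..-a})"
    using ode_lipschitz_solution_exists[of "-b" "-a" "\<lambda>s x. - g (- s) x" L v0] \<open>a \<le> b\<close> by auto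
  show ?thesis
  proof
    show "(v \<circ> uminus) b = v0" by (simp add: v)
    fix s assume s: "s \<in> {a..b}"
    have "((v \<circ> uminus) has_vector_derivative (-1) *\<^sub>R (- g (- (- s)) (v (- s)))) (at s within {a..b})"
      using s v(2)[of "- s"]
      by (intro vector_diff_chain_within) (auto intro!: derivative_eq_intros)
    then show "((v \<circ> uminus) has_vector_derivative g s ((v \<circ> uminus) s)) (at s within {a..b})" by simp
  qed
qed

section \<open>The quadratic right-hand side\<close>

text \<open>The Euclidean norm of a matrix or tensor is the L2 norm of the norms of its slices, so a
  slicewise estimate with a common factor suffices. Matrix-vector, tensor-vector and matrix-matrix
  products are all estimated this way.\<close>

lemma norm_vec_le_mult:
  fixes x :: "'a::real_normed_vector^'n" and y :: "'b::real_normed_vector^'n"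
  assumes "\<And>i. norm (x $ i) \<le> norm (y $ i) * c" and "0 \<le> c"
  shows "norm x \<le> norm y * c"
proof -
  have "norm x \<le> L2_set (\<lambda>i. norm (y $ i) * c) UNIV"
    unfolding norm_vec_def using assms by (intro L2_set_mono) auto
  also have "\<dots> = norm y * c"
    using assms by (simp add: norm_vec_def L2_set_left_distrib)
  finally show ?thesis .
qed

lemma norm_matrix_vector_mult_le:
  fixes A :: "real^'n^'m"
  shows "norm (A *v x) \<le> norm A * norm x"
  by (rule norm_vec_le_mult) (simp_all add: matrix_mult_dot Cauchy_Schwarz_ineq2)

lemma inner_matrix_def:
  fixes A B :: "real^'n^'m"
  shows "A \<bullet> B = (\<Sum>i\<in>UNIV. \<Sum>j\<in>UNIV. A $ i $ j * B $ i $ j)"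
  by (simp add: inner_vec_def)

lemma norm_transpose [simp]:
  fixes A :: "real^'n^'m"
  shows "norm (transpose A) = norm A"
proof -
  have "transpose A \<bullet> transpose A = A \<bullet> A"
    unfolding inner_matrix_def by (subst sum.swap) (simp add: transpose_def)
  then show ?thesis by (simp add: norm_eq_sqrt_inner)
qed

lemma bounded_bilinear_matrix_vector_mult:
  "bounded_bilinear ((*v) :: real^'n^'m \<Rightarrow> real^'n \<Rightarrow> real^'m)"
  by (auto simp flip: bilinear_conv_bounded_bilinear simp: bilinear_def
      intro!: linearI matrix_vector_mult_add_rdistrib matrix_vector_right_distrib
      scaleR_matrix_vector_assoc[symmetric] matrix_vector_mult_scaleR)

lemma bounded_linear_transpose: "bounded_linear (transpose :: real^'n^'m \<Rightarrow> real^'m^'n)"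
  by (auto simp flip: linear_conv_bounded_linear intro!: linearI
      simp: transpose_def vec_eq_iff)

text \<open>Contracting only the last index writes the quadratic term as a composition of two
  bilinear maps. Continuity, differentiation and norm estimates then come from the rules for
  \<open>bounded_bilinear\<close>.\<close>

definition tensor_contract :: "real^'r^'r^'r \<Rightarrow> real^'r \<Rightarrow> real^'r^'r" where
  "tensor_contract H z = (\<chi> a. H $ a *v z)"

lemma norm_tensor_contract_le: "norm (tensor_contract H z) \<le> norm H * norm z"
  by (rule norm_vec_le_mult) (simp_all add: tensor_contract_def norm_matrix_vector_mult_le)

lemma bounded_bilinear_tensor_contract: "bounded_bilinear tensor_contract"
  by (auto simp flip: bilinear_conv_bounded_bilinear simp: bilinear_def
      tensor_contract_def vec_eq_iff intro!: linearI)
    (simp_all add: algebra_simps flip: scaleR_matrix_vector_assoc)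

lemma tensor_quad_eq: "tensor_quad H z = tensor_contract H z *v z"
  by (simp add: tensor_quad_def tensor_contract_def matrix_vector_mult_def vec_eq_iff
      sum_distrib_left sum_distrib_right mult_ac)

lemmas continuous_on_matrix_vector_mult =
  bounded_bilinear.continuous_on[OF bounded_bilinear_matrix_vector_mult]
lemmas continuous_on_tensor_contract =
  bounded_bilinear.continuous_on[OF bounded_bilinear_tensor_contract]

section \<open>Dependence of the dynamics on state, input and operators\<close>

lemma continuous_on_rom_rhs:
  assumes "continuous_on S f" "continuous_on S g"
  shows "continuous_on S (\<lambda>s. rom_rhs A H B (f s) (g s))"
  unfolding rom_rhs_def tensor_quad_eq
  by (intro continuous_intros continuous_on_matrix_vector_mult continuous_on_tensor_contract assms)

lemma tensor_contract_simps:
  "tensor_contract (H + H') z = tensor_contract H z + tensor_contract H' z"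
  "tensor_contract (H - H') z = tensor_contract H z - tensor_contract H' z"
  "tensor_contract (c *\<^sub>R H) z = c *\<^sub>R tensor_contract H z"
  "tensor_contract H (z + z') = tensor_contract H z + tensor_contract H z'"
  "tensor_contract H (z - z') = tensor_contract H z - tensor_contract H z'"
  "tensor_contract H (c *\<^sub>R z) = c *\<^sub>R tensor_contract H z"
  by (simp_all add: bounded_bilinear.add_left bounded_bilinear.diff_left
      bounded_bilinear.scaleR_left bounded_bilinear.add_right bounded_bilinear.diff_right
      bounded_bilinear.scaleR_right bounded_bilinear_tensor_contract)

lemma matrix_vector_mult_simps:
  fixes A :: "real^'n^'m"
  shows "(A + A') *v z = A *v z + A' *v z"
  "(A - A') *v z = A *v z - A' *v z"
  "(c *\<^sub>R A) *v z = c *\<^sub>R (A *v z)"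
  "A *v (z + z') = A *v z + A *v z'"
  "A *v (z - z') = A *v z - A *v z'"
  "A *v (c *\<^sub>R z) = c *\<^sub>R (A *v z)"
  by (simp_all add: bounded_bilinear.add_left bounded_bilinear.diff_left
      bounded_bilinear.scaleR_left bounded_bilinear.add_right bounded_bilinear.diff_right
      bounded_bilinear.scaleR_right bounded_bilinear_matrix_vector_mult)

lemma rom_rhs_linear:
  "rom_rhs (A + A') (H + H') (B + B') z v = rom_rhs A H B z v + rom_rhs A' H' B' z v"
  "rom_rhs (A - A') (H - H') (B - B') z v = rom_rhs A H B z v - rom_rhs A' H' B' z v"
  "rom_rhs (c *\<^sub>R A) (c *\<^sub>R H) (c *\<^sub>R B) z v = c *\<^sub>R rom_rhs A H B z v"
  by (simp_all add: rom_rhs_def tensor_quad_eq tensor_contract_simps matrix_vector_mult_simps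
      scaleR_add_right)

lemma norm_rom_rhs_le:
  "norm (rom_rhs A H B z v) \<le> norm A * norm z + norm H * (norm z)\<^sup>2 + norm B * norm v"
proof -
  have "norm (tensor_contract H z *v z) \<le> norm H * (norm z)\<^sup>2"
    using order_trans[OF norm_matrix_vector_mult_le
        mult_right_mono[OF norm_tensor_contract_le]]
    by (simp add: power2_eq_square mult.assoc)
  then show ?thesis
    unfolding rom_rhs_def tensor_quad_eq
    by (intro norm_triangle_mono norm_matrix_vector_mult_le)
qed

lemma norm_tensor_contract_mult_le: "norm (tensor_contract H x *v y) \<le> norm H * norm x * norm y"
  by (rule order_trans[OF norm_matrix_vector_mult_le])
    (simp add: norm_tensor_contract_le mult_right_mono)

lemma norm_rom_rhs_diff_le:
  "norm (rom_rhs A H B x v - rom_rhs A H B x' v)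
    \<le> (norm A + norm H * (norm x + norm x')) * norm (x - x')"
proof -
  \<comment> \<open>The quadratic difference telescopes through the mixed term
    \<open>tensor_contract H x *v x'\<close>.\<close>
  have "rom_rhs A H B x v - rom_rhs A H B x' v
      = A *v (x - x') + (tensor_contract H x *v (x - x') + tensor_contract H (x - x') *v x')"
    by (simp add: rom_rhs_def tensor_quad_eq tensor_contract_simps matrix_vector_mult_simps)
  also have "norm \<dots> \<le> norm A * norm (x - x')
      + (norm H * norm x * norm (x - x') + norm H * norm (x - x') * norm x')"
    by (intro norm_triangle_mono norm_matrix_vector_mult_le norm_tensor_contract_mult_le)
  finally show ?thesis by (simp add: algebra_simps)
qed

text \<open>The linearization in the state. Both contractions occur because \<open>H\<close> is not
  assumed symmetric in its last two indices.\<close>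

definition rom_lin :: "real^'r^'r \<Rightarrow> real^'r^'r^'r \<Rightarrow> real^'r \<Rightarrow> real^'r \<Rightarrow> real^'r" where
  "rom_lin A H z d = A *v d + (tensor_contract H z *v d + tensor_contract H d *v z)"

lemma rom_rhs_has_derivative:
  "((\<lambda>w. rom_rhs A H B w v) has_derivative rom_lin A H z) (at z)"
  unfolding rom_rhs_def tensor_quad_eq rom_lin_def
  by (auto intro!: derivative_eq_intros
      bounded_bilinear.FDERIV[OF bounded_bilinear_matrix_vector_mult]
      bounded_linear.has_derivative[OF bounded_bilinear.bounded_linear_right[OF bounded_bilinear_tensor_contract]]
      bounded_linear.has_derivative[OF matrix_vector_mul_bounded_linear])

lemma jacobian_rom_rhs:
  "jacobian (\<lambda>w. rom_rhs A H B w v) (at z) = matrix (rom_lin A H z)"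
  unfolding jacobian_def using frechet_derivative_at[OF rom_rhs_has_derivative] by metis

text \<open>This pairing is what lets the adjoint equation cancel the linearized dynamics of the
  trajectory difference.\<close>

lemma inner_transpose_jacobian_rom_rhs:
  "(transpose (jacobian (\<lambda>w. rom_rhs A H B w v) (at z)) *v l) \<bullet> d = l \<bullet> rom_lin A H z d"
proof -
  have "linear (rom_lin A H z)"
    using rom_rhs_has_derivative by (rule has_derivative_linear)
  then show ?thesis
    by (simp add: jacobian_rom_rhs dot_lmul_matrix matrix_works)
qed

text \<open>Once the first-order terms in the operators and in the state are removed, every
  remaining term has two small factors. Keeping \<open>H'\<close> rather than \<open>H\<close> in
  the term quadratic in \<open>w - z\<close> takes in the cubic term.\<close>

lemma norm_rom_rhs_remainder_le:
  "norm (rom_rhs A' H' B' w v - rom_rhs A H B z v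
      - rom_rhs (A' - A) (H' - H) (B' - B) z v - rom_lin A H z (w - z))
    \<le> norm (A' - A) * norm (w - z) + norm H' * (norm (w - z))\<^sup>2
      + 2 * norm (H' - H) * norm z * norm (w - z)"
proof -
  define d where "d = w - z"
  then have w: "w = z + d" by simp
  have "rom_rhs A' H' B' w v - rom_rhs A H B z v
      - rom_rhs (A' - A) (H' - H) (B' - B) z v - rom_lin A H z d
    = (A' - A) *v d + (tensor_contract H' d *v d
      + (tensor_contract (H' - H) z *v d + tensor_contract (H' - H) d *v z))"
    unfolding w by (simp add: rom_rhs_def rom_lin_def tensor_quad_eq tensor_contract_simps matrix_vector_mult_simps)
  also have "norm \<dots> \<le> norm (A' - A) * norm d + (norm H' * norm d * norm d
      + (norm (H' - H) * norm z * norm d + norm (H' - H) * norm d * norm z))"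
    by (intro norm_triangle_mono norm_matrix_vector_mult_le norm_tensor_contract_mult_le)
  finally show ?thesis unfolding d_def by (simp add: algebra_simps power2_eq_square)
qed

section \<open>Boundedness and uniqueness of trajectories\<close>

lemma rom_solution_continuous_on:
  assumes "rom_solution t N x0 u \<Psi> A H B z"
  shows "continuous_on {t 0..t (N - 1)} z"
  using assms unfolding rom_solution_def
  by (meson has_vector_derivative_continuous continuous_on_eq_continuous_within)

lemma continuous_on_Icc_norm_bound:
  fixes f :: "real \<Rightarrow> 'a::real_normed_vector"
  assumes "continuous_on {a..b} f"
  obtains M where "0 \<le> M" "\<And>s. s \<in> {a..b} \<Longrightarrow> norm (f s) \<le> M"
proof -
  have "bounded (f ` {a..b})"
    using assms by (intro compact_imp_bounded compact_continuous_image) auto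
  then obtain M where "0 < M" "\<forall>x\<in>f ` {a..b}. norm x \<le> M"
    unfolding bounded_pos by blast
  then show ?thesis by (intro that[of M]) auto
qed

text \<open>The dynamics is only locally Lipschitz, but two given trajectories are bounded on the
  compact interval. The energy estimate then applies to their difference with zero initial value and
  zero forcing.\<close>

lemma rom_solution_unique:
  assumes w1: "rom_solution t N x0 u \<Psi> A H B w1" and w2: "rom_solution t N x0 u \<Psi> A H B w2"
    and s: "s \<in> {t 0..t (N - 1)}"
  shows "w1 s = w2 s"
proof -
  obtain M1 where M1: "0 \<le> M1" "\<And>s. s \<in> {t 0..t (N - 1)} \<Longrightarrow> norm (w1 s) \<le> M1"
    using continuous_on_Icc_norm_bound[OF rom_solution_continuous_on[OF w1]] by metis
  obtain M2 where M2: "0 \<le> M2" "\<And>s. s \<in> {t 0..t (N - 1)} \<Longrightarrow> norm (w2 s) \<le> M2"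
    using continuous_on_Icc_norm_bound[OF rom_solution_continuous_on[OF w2]] by metis
  define L where "L = norm A + norm H * (M1 + M2)"
  have "(norm (w1 s - w2 s))\<^sup>2 \<le> exp ((2 * L + 1) * (s - t 0))
      * ((norm (w1 (t 0) - w2 (t 0)))\<^sup>2 + 0\<^sup>2 * (s - t 0))"
  proof (rule ode_energy_bound[OF _ _ _ s])
    fix r assume r: "r \<in> {t 0..t (N - 1)}"
    show "((\<lambda>s. w1 s - w2 s) has_vector_derivative
        rom_rhs A H B (w1 r) (u r) - rom_rhs A H B (w2 r) (u r)) (at r within {t 0..t (N - 1)})"
      using w1 w2 r unfolding rom_solution_def by (intro has_vector_derivative_diff) auto
    have "norm (rom_rhs A H B (w1 r) (u r) - rom_rhs A H B (w2 r) (u r))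
        \<le> (norm A + norm H * (norm (w1 r) + norm (w2 r))) * norm (w1 r - w2 r)"
      by (rule norm_rom_rhs_diff_le)
    also have "\<dots> \<le> L * norm (w1 r - w2 r)"
      unfolding L_def using M1 M2 r by (intro mult_right_mono add_left_mono mult_left_mono add_mono) auto
    finally show "norm (rom_rhs A H B (w1 r) (u r) - rom_rhs A H B (w2 r) (u r))
        \<le> L * norm (w1 r - w2 r) + 0" by simp
  qed (use M1(1) M2(1) in \<open>simp add: L_def\<close>)
  then show ?thesis using w1 w2 by (simp add: rom_solution_def)
qed

lemma norm_Pair4_le:
  "norm a \<le> norm (a, b, c, d)" "norm b \<le> norm (a, b, c, d)"
  "norm c \<le> norm (a, b, c, d)" "norm d \<le> norm (a, b, c, d)"
  by (metis norm_fst_le norm_snd_le fst_conv snd_conv order_trans)+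

section \<open>Perturbed solutions\<close>

text \<open>Existence for nearby parameters and Lipschitz dependence on them come together, by
  solving a truncated equation for the difference from \<open>z\<close> instead of for the perturbed
  trajectory itself.\<close>

lemma rom_solution_perturb:
  fixes t :: "nat \<Rightarrow> real" and x0 :: "real^'n" and u :: "real \<Rightarrow> real^'m"
    and \<Psi> :: "real^'r^'n" and A :: "real^'r^'r" and H :: "real^'r^'r^'r" and B :: "real^'m^'r"
  assumes t: "t 0 \<le> t (N - 1)"
    and u: "continuous_on {t 0..t (N - 1)} u"
    and z: "rom_solution t N x0 u \<Psi> A H B z"
  obtains K \<epsilon> where "0 \<le> K" "0 < \<epsilon>" "\<epsilon> \<le> 1"
    and "\<And>\<Psi>' A' H' B'. dist (\<Psi>', A', H', B') (\<Psi>, A, H, B) < \<epsilon> \<Longrightarrow>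
      \<exists>w. rom_solution t N x0 u \<Psi>' A' H' B' w \<and>
        (\<forall>s\<in>{t 0..t (N - 1)}. norm (w s - z s) \<le> K * dist (\<Psi>', A', H', B') (\<Psi>, A, H, B))"
proof -
  define I where "I = {t 0..t (N - 1)}"
  have z_cont: "continuous_on I z"
    using rom_solution_continuous_on[OF z] by (simp add: I_def)
  obtain M where M: "0 \<le> M" "\<And>s. s \<in> I \<Longrightarrow> norm (z s) \<le> M"
    using continuous_on_Icc_norm_bound[OF z_cont[unfolded I_def]] unfolding I_def by metis
  obtain U where U: "0 \<le> U" "\<And>s. s \<in> I \<Longrightarrow> norm (u s) \<le> U"
    using continuous_on_Icc_norm_bound[OF u] unfolding I_def by metis
  \<comment> \<open>A Lipschitz constant uniform over all admissible perturbations: parameters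
    within distance 1 raise each operator norm by at most 1, and both states in the difference
    estimate have norm at most \<open>M + 1\<close>.\<close>
  define L where "L = (norm A + 1) + (norm H + 1) * (2 * (M + 1))"
  \<comment> \<open>\<open>Q\<close> bounds the forcing per unit of parameter change: a change of
    \<open>A\<close>, \<open>H\<close> or \<open>B\<close> acts on \<open>z\<close>, on its square
    or on \<open>u\<close>.\<close>
  define Q where "Q = M + M\<^sup>2 + U"
  define T where "T = t (N - 1) - t 0"
  \<comment> \<open>The energy estimate with initial size \<delta> times \<open>norm x0\<close> and
    forcing \<delta> times \<open>Q\<close>, after taking out \<delta> and the square root.\<close>
  define K where "K = sqrt (exp ((2 * L + 1) * T) * ((norm x0)\<^sup>2 + Q\<^sup>2 * T))"
  define \<epsilon> where "\<epsilon> = min 1 (1 / (K + 1))"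
  \<comment> \<open>Projection onto the unit ball is 1-Lipschitz and the identity inside, so
    inserting it makes the field globally Lipschitz without changing it in the tube of radius 1
    around \<open>z\<close>.\<close>
  define \<pi> where "\<pi> = closest_point (cball (0::real^'r) 1)"
  have "0 \<le> L" using M(1) by (auto simp: L_def)
  have "0 \<le> T" using t by (simp add: T_def)
  have "0 \<le> Q" using M(1) U(1) by (simp add: Q_def)
  have "0 \<le> K" using \<open>0 \<le> T\<close> by (simp add: K_def)
  have \<pi>_norm: "norm (\<pi> v) \<le> 1" for v
    using closest_point_in_set[of "cball (0::real^'r) 1" v] by (simp add: \<pi>_def)
  have \<pi>_lip: "norm (\<pi> v - \<pi> w) \<le> norm (v - w)" for v w
    using closest_point_lipschitz[of "cball (0::real^'r) 1" v w] by (simp add: \<pi>_def dist_norm)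
  have \<pi>_id: "\<pi> v = v" if "norm v \<le> 1" for v
    using that by (simp add: \<pi>_def closest_point_self)
  have \<pi>_cont: "continuous_on S \<pi>" for S
    unfolding \<pi>_def by (rule continuous_on_closest_point) auto
  have "\<exists>w. rom_solution t N x0 u \<Psi>' A' H' B' w \<and> (\<forall>s\<in>I. norm (w s - z s) \<le> K * \<delta>)"
    if \<delta>: "\<delta> = dist (\<Psi>', A', H', B') (\<Psi>, A, H, B)" and "\<delta> < \<epsilon>" for \<Psi>' A' H' B' \<delta>
  proof -
    have small: "norm (\<Psi>' - \<Psi>) \<le> \<delta>" "norm (A' - A) \<le> \<delta>" "norm (H' - H) \<le> \<delta>" "norm (B' - B) \<le> \<delta>"
      unfolding \<delta> dist_norm by (simp_all add: norm_Pair4_le)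
    have "0 \<le> \<delta>" by (simp add: \<delta>)
    have "\<delta> \<le> 1" using \<open>\<delta> < \<epsilon>\<close> by (simp add: \<epsilon>_def)
    have A': "norm A' \<le> norm A + 1" and H': "norm H' \<le> norm H + 1"
      using small \<open>\<delta> \<le> 1\<close> norm_triangle_sub[of A' A] norm_triangle_sub[of H' H] by auto
    \<comment> \<open>The truncated equation for the difference of trajectories. At
      \<open>v = 0\<close> only the change of the operators remains, which makes
      \<open>g s 0\<close> of order \<delta>.\<close>
    define g where "g s v = rom_rhs A' H' B' (z s + \<pi> v) (u s) - rom_rhs A H B (z s) (u s)" for s v
    have fz: "norm (z s + \<pi> v) \<le> M + 1" if "s \<in> I" for s v
      using norm_triangle_mono[OF M(2)[OF that] \<pi>_norm] .
    have g_diff: "norm (g s v - g s w) \<le> L * norm (v - w)" if s: "s \<in> I" for s v w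
    proof -
      have "norm (g s v - g s w) \<le> (norm A' + norm H' * (norm (z s + \<pi> v) + norm (z s + \<pi> w)))
          * norm ((z s + \<pi> v) - (z s + \<pi> w))"
        using norm_rom_rhs_diff_le[of A' H' B' "z s + \<pi> v" "u s" "z s + \<pi> w"] by (simp add: g_def)
      also have "\<dots> \<le> L * norm (v - w)"
        unfolding L_def using fz[OF s, of v] fz[OF s, of w] A' H' \<pi>_lip[of v w] M(1)
        by (intro mult_mono add_mono) auto
      finally show ?thesis .
    qed
    have g_lip: "L-lipschitz_on UNIV (g s)" if "s \<in> I" for s
      using g_diff[OF that] \<open>0 \<le> L\<close> by (auto intro!: lipschitz_onI simp: dist_norm)
    have g0: "norm (g s 0) \<le> Q * \<delta>" if s: "s \<in> I" for s
    proof -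
      have "g s 0 = rom_rhs (A' - A) (H' - H) (B' - B) (z s) (u s)"
        by (simp add: g_def \<pi>_id rom_rhs_linear)
      also have "norm \<dots> \<le> norm (A' - A) * norm (z s) + norm (H' - H) * (norm (z s))\<^sup>2
          + norm (B' - B) * norm (u s)"
        by (rule norm_rom_rhs_le)
      also have "\<dots> \<le> \<delta> * M + \<delta> * M\<^sup>2 + \<delta> * U"
        using small M U s \<open>0 \<le> \<delta>\<close> by (intro add_mono mult_mono power_mono) auto
      finally show ?thesis by (simp add: Q_def algebra_simps)
    qed
    have g_cont: "continuous_on (I \<times> UNIV) (\<lambda>(s, v). g s v)"
      unfolding g_def split_beta I_def
      by (intro continuous_intros continuous_on_rom_rhs
          continuous_on_compose2[OF rom_solution_continuous_on[OF z] continuous_on_fst]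
          continuous_on_compose2[OF u continuous_on_fst]
          continuous_on_compose2[OF \<pi>_cont[of UNIV] continuous_on_snd]) auto
    obtain v where v: "v (t 0) = transpose (\<Psi>' - \<Psi>) *v x0"
      "\<And>s. s \<in> I \<Longrightarrow> (v has_vector_derivative g s (v s)) (at s within I)"
      using ode_lipschitz_solution_exists[OF t g_cont[unfolded I_def] g_lip[unfolded I_def],
          of "transpose (\<Psi>' - \<Psi>) *v x0"] unfolding I_def by metis
    have v_le: "norm (v s) \<le> K * \<delta>" if s: "s \<in> I" for s
    proof -
      have "(norm (v s))\<^sup>2 \<le> exp ((2 * L + 1) * (s - t 0)) * ((norm (v (t 0)))\<^sup>2 + (Q * \<delta>)\<^sup>2 * (s - t 0))"
      proof (rule ode_energy_bound[OF v(2)[unfolded I_def] _ \<open>0 \<le> L\<close> s[unfolded I_def]])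
        fix r assume "r \<in> {t 0..t (N - 1)}"
        then have r: "r \<in> I" by (simp add: I_def)
        show "norm (g r (v r)) \<le> L * norm (v r) + Q * \<delta>"
          using norm_triangle_sub[of "g r (v r)" "g r 0"] g_diff[OF r, of "v r" 0] g0[OF r] by simp
      qed
      also have "\<dots> \<le> exp ((2 * L + 1) * T) * ((\<delta> * norm x0)\<^sup>2 + (Q * \<delta>)\<^sup>2 * T)"
      proof (intro mult_mono add_mono power_mono)
        show "norm (v (t 0)) \<le> \<delta> * norm x0"
          unfolding v using norm_matrix_vector_mult_le[of "transpose (\<Psi>' - \<Psi>)" x0] small(1)
          by (simp add: order_trans[OF _ mult_right_mono])
        show "exp ((2 * L + 1) * (s - t 0)) \<le> exp ((2 * L + 1) * T)"
          using s \<open>0 \<le> L\<close> by (auto simp: T_def I_def intro!: mult_left_mono)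
      qed (use s \<open>0 \<le> L\<close> \<open>0 \<le> Q\<close> \<open>0 \<le> \<delta>\<close> in \<open>auto simp: T_def I_def\<close>)
      also have "\<dots> = (K * \<delta>)\<^sup>2"
      proof -
        have "K\<^sup>2 = exp ((2 * L + 1) * T) * ((norm x0)\<^sup>2 + Q\<^sup>2 * T)"
          using \<open>0 \<le> T\<close> unfolding K_def by (intro real_sqrt_pow2) simp
        then show ?thesis
          by (simp only: power_mult_distrib) (simp add: distrib_left distrib_right mult_ac)
      qed
      finally show ?thesis
        using \<open>0 \<le> K\<close> \<open>0 \<le> \<delta>\<close> by (intro power2_le_imp_le[of "norm (v s)" "K * \<delta>"]) simp_all
    qed
    \<comment> \<open>By the choice of \<epsilon> the a priori bound keeps \<open>v\<close> in the
      unit ball. There the truncation is inactive, so \<open>z + v\<close> solves the original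
      equation.\<close>
    have "\<delta> * (K + 1) < 1"
      using \<open>\<delta> < \<epsilon>\<close> \<open>0 \<le> K\<close> by (simp add: \<epsilon>_def pos_less_divide_eq)
    then have "K * \<delta> \<le> 1" using \<open>0 \<le> \<delta>\<close> by (simp add: algebra_simps)
    have "rom_solution t N x0 u \<Psi>' A' H' B' (\<lambda>s. z s + v s)"
      unfolding rom_solution_def I_def[symmetric]
    proof (intro conjI ballI)
      show "z (t 0) + v (t 0) = transpose \<Psi>' *v x0"
        using z v by (simp add: rom_solution_def bounded_linear.linear[OF bounded_linear_transpose]
            linear_diff matrix_vector_mult_simps)
      fix s assume s: "s \<in> I"
      have "\<pi> (v s) = v s" using v_le[OF s] \<open>K * \<delta> \<le> 1\<close> by (intro \<pi>_id) simp
      then have "rom_rhs A' H' B' (z s + v s) (u s) = rom_rhs A H B (z s) (u s) + g s (v s)"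
        by (simp add: g_def)
      then show "((\<lambda>s. z s + v s) has_vector_derivative rom_rhs A' H' B' (z s + v s) (u s)) (at s within I)"
        using z v(2)[OF s] s by (auto simp: rom_solution_def I_def intro!: has_vector_derivative_add)
    qed
    then show ?thesis using v_le by (intro exI[of _ "\<lambda>s. z s + v s"]) simp
  qed
  moreover have "0 < \<epsilon>" "\<epsilon> \<le> 1" using \<open>0 \<le> K\<close> by (auto simp: \<epsilon>_def)
  ultimately show ?thesis using that[of K \<epsilon>] \<open>0 \<le> K\<close> unfolding I_def by metis
qed

lemma rom_flow_eq:
  assumes "rom_solution t N x0 u \<Psi> A H B z" and "s \<in> {t 0..t (N - 1)}"
  shows "rom_flow t N x0 u \<Psi> A H B s = z s"
  using assms rom_solution_unique unfolding rom_flow_def by (metis someI_ex)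

text \<open>After division by the distance the remainder is still of first order. This criterion
  serves both the trajectory and the matrix inverse.\<close>

lemma has_derivative_quadratic_remainder:
  fixes f :: "'a::real_normed_vector \<Rightarrow> 'b::real_normed_vector"
  assumes "bounded_linear D" and "0 < \<epsilon>"
    and rem: "\<And>y. dist y x < \<epsilon> \<Longrightarrow> norm (f y - f x - D (y - x)) \<le> c * (dist y x)\<^sup>2"
  shows "(f has_derivative D) (at x)"
proof (rule has_derivativeI_sandwich[OF \<open>0 < \<epsilon>\<close> \<open>bounded_linear D\<close>])
  show "norm (f y - f x - D (y - x)) / norm (y - x) \<le> c * dist y x"
    if "y \<noteq> x" "dist y x < \<epsilon>" for y
    using rem[OF that(2)] that(1) by (simp add: divide_le_eq dist_norm power2_eq_square)
  have "((\<lambda>y. c * dist y x) \<longlongrightarrow> c * dist x x) (at x)"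
    by (intro tendsto_intros)
  then show "((\<lambda>y. c * dist y x) \<longlongrightarrow> 0) (at x)" by simp
qed

section \<open>The adjoint equation\<close>

text \<open>The terminal condition is left out on purpose: differentiability of the trajectory is
  obtained by letting the terminal vector range over the whole space.\<close>

definition rom_adjoint where
  "rom_adjoint a b A H B u z lam \<longleftrightarrow> (\<forall>s\<in>{a..b}. (lam has_vector_derivative
      - (transpose (jacobian (\<lambda>w. rom_rhs A H B w (u s)) (at (z s))) *v lam s)) (at s within {a..b}))"

lemma rom_adjoint_continuous_on:
  assumes "rom_adjoint a b A H B u z lam"
  shows "continuous_on {a..b} lam"
  using assms unfolding rom_adjoint_def
  by (meson has_vector_derivative_continuous continuous_on_eq_continuous_within)

text \<open>The equation is linear in \<open>lam\<close>, and its coefficient matrix is continuous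
  along \<open>z\<close>, hence bounded. So it is globally Lipschitz and can be solved backwards
  from any terminal vector.\<close>

lemma rom_adjoint_exists:
  fixes z :: "real \<Rightarrow> real^'r"
  assumes "a \<le> b" and z: "continuous_on {a..b} z"
  obtains lam where "rom_adjoint a b A H B u z lam" "lam b = l"
proof -
  define J where "J s = transpose (matrix (rom_lin A H (z s)))" for s
  have "continuous_on {a..b} (\<lambda>s. matrix (rom_lin A H (z s)))"
    unfolding matrix_def rom_lin_def
    by (intro continuous_on_vec_lambda continuous_on_component continuous_intros
        continuous_on_matrix_vector_mult continuous_on_tensor_contract z)
  then have J: "continuous_on {a..b} J"
    unfolding J_def by (rule bounded_linear.continuous_on[OF bounded_linear_transpose])
  obtain L where L: "0 \<le> L" "\<And>s. s \<in> {a..b} \<Longrightarrow> norm (J s) \<le> L"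
    using continuous_on_Icc_norm_bound[OF J] by metis
  have "continuous_on ({a..b} \<times> UNIV) (\<lambda>(s, x). - (J s *v x))"
    unfolding split_beta
    by (intro continuous_intros continuous_on_matrix_vector_mult
        continuous_on_compose2[OF J continuous_on_fst]) auto
  moreover have "L-lipschitz_on UNIV (\<lambda>x. - (J s *v x))" if s: "s \<in> {a..b}" for s
  proof (rule lipschitz_onI[OF _ L(1)])
    fix x y
    have "norm (J s *v (y - x)) \<le> norm (J s) * norm (y - x)"
      by (rule norm_matrix_vector_mult_le)
    also have "\<dots> \<le> L * norm (y - x)"
      using L(2)[OF s] by (rule mult_right_mono) simp
    finally show "dist (- (J s *v x)) (- (J s *v y)) \<le> L * dist x y"
      by (simp add: dist_norm norm_minus_commute matrix_vector_mult_simps)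
  qed
  ultimately obtain lam where "lam b = l"
    "\<And>s. s \<in> {a..b} \<Longrightarrow> (lam has_vector_derivative - (J s *v lam s)) (at s within {a..b})"
    using ode_lipschitz_terminal_solution_exists[OF \<open>a \<le> b\<close>, of "\<lambda>s x. - (J s *v x)" L l] by metis
  then show ?thesis
    by (intro that[of lam]) (auto simp: rom_adjoint_def J_def jacobian_rom_rhs)
qed

lemma rom_flow_adjoint_has_derivative:
  fixes t :: "nat \<Rightarrow> real" and x0 :: "real^'n" and u :: "real \<Rightarrow> real^'m"
    and \<Psi> :: "real^'r^'n" and A :: "real^'r^'r" and H :: "real^'r^'r^'r" and B :: "real^'m^'r"
  assumes t: "t 0 \<le> t (N - 1)"
    and u: "continuous_on {t 0..t (N - 1)} u"
    and z: "rom_solution t N x0 u \<Psi> A H B z"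
    and b: "b \<in> {t 0..t (N - 1)}"
    and lam: "rom_adjoint (t 0) b A H B u z lam"
  shows "((\<lambda>(\<Psi>', A', H', B'). lam b \<bullet> rom_flow t N x0 u \<Psi>' A' H' B' b) has_derivative
      (\<lambda>(d\<Psi>, dA, dH, dB). lam (t 0) \<bullet> (transpose d\<Psi> *v x0)
        + integral {t 0..b} (\<lambda>s. lam s \<bullet> rom_rhs dA dH dB (z s) (u s)))) (at (\<Psi>, A, H, B))"
    (is "(?f has_derivative ?D) _")
proof -
  define I where "I = {t 0..b}"
  have I: "I \<subseteq> {t 0..t (N - 1)}" using b by (auto simp: I_def)
  have z_cont: "continuous_on I z"
    using continuous_on_subset[OF rom_solution_continuous_on[OF z] I] .
  have u_cont: "continuous_on I u" using continuous_on_subset[OF u I] .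
  have lam_cont: "continuous_on I lam"
    using rom_adjoint_continuous_on[OF lam] by (simp add: I_def)
  obtain M where M: "0 \<le> M" "\<And>s. s \<in> I \<Longrightarrow> norm (z s) \<le> M"
    using continuous_on_Icc_norm_bound[OF z_cont[unfolded I_def]] unfolding I_def by metis
  obtain \<Lambda> where \<Lambda>: "0 \<le> \<Lambda>" "\<And>s. s \<in> I \<Longrightarrow> norm (lam s) \<le> \<Lambda>"
    using continuous_on_Icc_norm_bound[OF lam_cont[unfolded I_def]] unfolding I_def by metis
  obtain K \<epsilon> where K: "0 \<le> K" and \<epsilon>: "0 < \<epsilon>" "\<epsilon> \<le> 1"
    and perturb: "\<And>\<Psi>' A' H' B'. dist (\<Psi>', A', H', B') (\<Psi>, A, H, B) < \<epsilon> \<Longrightarrow>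
      \<exists>w. rom_solution t N x0 u \<Psi>' A' H' B' w \<and>
        (\<forall>s\<in>{t 0..t (N - 1)}. norm (w s - z s) \<le> K * dist (\<Psi>', A', H', B') (\<Psi>, A, H, B))"
    using rom_solution_perturb[OF t u z] by metis
  \<comment> \<open>The three summands bound, after \<delta>^2 is taken out, the three remainder
    terms of \<open>norm_rom_rhs_remainder_le\<close>, with \<open>d\<close> of size at most
    \<open>K\<close> times \<delta>.\<close>
  define R where "R = K + (norm H + 1) * K\<^sup>2 + 2 * M * K"
  have "0 \<le> R" using K M by (simp add: R_def)
  have cont: "continuous_on I (\<lambda>s. lam s \<bullet> rom_rhs dA dH dB (z s) (u s))"
    for dA :: "real^'r^'r" and dH :: "real^'r^'r^'r" and dB :: "real^'m^'r"
    by (intro continuous_on_inner lam_cont continuous_on_rom_rhs z_cont u_cont)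
  have int: "(\<lambda>s. lam s \<bullet> rom_rhs dA dH dB (z s) (u s)) integrable_on I"
    for dA :: "real^'r^'r" and dH :: "real^'r^'r^'r" and dB :: "real^'m^'r"
    using cont unfolding I_def by (rule integrable_continuous_real)
  show ?thesis
  proof (rule has_derivative_quadratic_remainder[OF _ \<epsilon>(1)])
    note tr = linear_add[OF bounded_linear.linear[OF bounded_linear_transpose]]
      linear_cmul[OF bounded_linear.linear[OF bounded_linear_transpose]]
    have "?D (\<theta> + \<theta>') = ?D \<theta> + ?D \<theta>'" for \<theta> \<theta>'
      by (cases \<theta>; cases \<theta>') (simp add: tr rom_rhs_linear inner_add_right int
            integral_add matrix_vector_mult_simps I_def[symmetric] del: transpose_matrix_vector)
    moreover have "?D (r *\<^sub>R \<theta>) = r *\<^sub>R ?D \<theta>" for r \<theta>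
      by (cases \<theta>) (simp add: tr rom_rhs_linear int distrib_left
            matrix_vector_mult_simps I_def[symmetric] del: transpose_matrix_vector)
    ultimately have "linear ?D" by (rule linearI)
    then show "bounded_linear ?D" by (simp add: linear_conv_bounded_linear)
    fix \<theta> assume near: "dist \<theta> (\<Psi>, A, H, B) < \<epsilon>"
    obtain \<Psi>' A' H' B' where \<theta>: "\<theta> = (\<Psi>', A', H', B')" by (metis prod_cases4)
    define \<delta> where "\<delta> = dist \<theta> (\<Psi>, A, H, B)"
    obtain w where w: "rom_solution t N x0 u \<Psi>' A' H' B' w"
      and wz: "\<And>s. s \<in> I \<Longrightarrow> norm (w s - z s) \<le> K * \<delta>" and \<delta>: "\<delta> < \<epsilon>"
      using perturb[of \<Psi>' A' H' B', folded \<theta>, OF near] I near unfolding \<delta>_def by blast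
    have small: "norm (A' - A) \<le> \<delta>" "norm (H' - H) \<le> \<delta>"
      unfolding \<delta>_def \<theta> dist_norm by (simp_all add: norm_Pair4_le)
    have "0 \<le> \<delta>" by (simp add: \<delta>_def)
    have H': "norm H' \<le> norm H + 1"
      using small(2) \<delta> \<epsilon> norm_triangle_sub[of H' H] by auto
    define d where "d s = w s - z s" for s
    define p where "p s = lam s \<bullet> rom_rhs (A' - A) (H' - H) (B' - B) (z s) (u s)" for s
    define \<rho> where "\<rho> s = rom_rhs A' H' B' (w s) (u s) - rom_rhs A H B (z s) (u s)
      - rom_rhs (A' - A) (H' - H) (B' - B) (z s) (u s) - rom_lin A H (z s) (d s)" for s
    have \<rho>: "norm (\<rho> s) \<le> R * \<delta>\<^sup>2" if s: "s \<in> I" for s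
    proof -
      have "norm (\<rho> s) \<le> norm (A' - A) * norm (d s) + norm H' * (norm (d s))\<^sup>2
          + 2 * norm (H' - H) * norm (z s) * norm (d s)"
        unfolding \<rho>_def d_def by (rule norm_rom_rhs_remainder_le)
      also have "\<dots> \<le> \<delta> * (K * \<delta>) + (norm H + 1) * (K * \<delta>)\<^sup>2 + 2 * \<delta> * M * (K * \<delta>)"
        using small H' wz[OF s] M s K \<open>0 \<le> \<delta>\<close>
        by (intro add_mono mult_mono power_mono) (auto simp: d_def)
      finally show ?thesis by (simp add: R_def algebra_simps power2_eq_square)
    qed
    have "((\<lambda>s. lam s \<bullet> d s) has_vector_derivative p s + lam s \<bullet> \<rho> s) (at s within I)"
      if s: "s \<in> I" for s
    proof -
      have "(d has_vector_derivative rom_rhs A' H' B' (w s) (u s) - rom_rhs A H B (z s) (u s)) (at s within I)"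
        using w z s I unfolding d_def rom_solution_def
        by (auto intro!: has_vector_derivative_diff elim!: has_vector_derivative_within_subset)
      moreover have "(lam has_vector_derivative
          - (transpose (jacobian (\<lambda>w. rom_rhs A H B w (u s)) (at (z s))) *v lam s)) (at s within I)"
        using lam s unfolding rom_adjoint_def I_def by blast
      ultimately have "((\<lambda>s. lam s \<bullet> d s) has_vector_derivative
          lam s \<bullet> (rom_rhs A' H' B' (w s) (u s) - rom_rhs A H B (z s) (u s))
          + (- (transpose (jacobian (\<lambda>w. rom_rhs A H B w (u s)) (at (z s))) *v lam s)) \<bullet> d s) (at s within I)"
        by (intro bounded_bilinear.has_vector_derivative[OF bounded_bilinear_inner])
      \<comment> \<open>The adjoint term cancels \<open>lam s\<close> paired with
        \<open>rom_lin A H z (d s)\<close>. Only the explicit parameter change \<open>p\<close> and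
        the second-order term remain.\<close>
      moreover have "lam s \<bullet> (rom_rhs A' H' B' (w s) (u s) - rom_rhs A H B (z s) (u s))
          + (- (transpose (jacobian (\<lambda>w. rom_rhs A H B w (u s)) (at (z s))) *v lam s)) \<bullet> d s
          = p s + lam s \<bullet> \<rho> s"
        by (simp add: inner_transpose_jacobian_rom_rhs p_def \<rho>_def inner_diff_right
            del: transpose_matrix_vector)
      ultimately show ?thesis by (simp only:)
    qed
    then have "((\<lambda>s. p s + lam s \<bullet> \<rho> s) has_integral lam b \<bullet> d b - lam (t 0) \<bullet> d (t 0)) I"
      unfolding I_def using b by (intro fundamental_theorem_of_calculus) auto
    moreover have "(p has_integral integral I p) I"
      unfolding p_def using int by (rule integrable_integral)
    ultimately have "((\<lambda>s. (p s + lam s \<bullet> \<rho> s) - p s) has_integral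
        lam b \<bullet> d b - lam (t 0) \<bullet> d (t 0) - integral I p) I"
      by (rule has_integral_diff)
    then have "((\<lambda>s. lam s \<bullet> \<rho> s) has_integral
        lam b \<bullet> d b - lam (t 0) \<bullet> d (t 0) - integral I p) I"
      by simp
    moreover have "norm (lam s \<bullet> \<rho> s) \<le> \<Lambda> * (R * \<delta>\<^sup>2)" if s: "s \<in> I" for s
    proof -
      have "norm (lam s \<bullet> \<rho> s) \<le> norm (lam s) * norm (\<rho> s)"
        by (simp add: Cauchy_Schwarz_ineq2)
      also have "\<dots> \<le> \<Lambda> * (R * \<delta>\<^sup>2)"
        using \<Lambda> \<rho>[OF s] s by (intro mult_mono) auto
      finally show ?thesis .
    qed
    ultimately have "norm (lam b \<bullet> d b - lam (t 0) \<bullet> d (t 0) - integral I p)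
        \<le> (\<Lambda> * (R * \<delta>\<^sup>2)) * (b - t 0)"
      using has_integral_bound[of "\<Lambda> * (R * \<delta>\<^sup>2)" "\<lambda>s. lam s \<bullet> \<rho> s" _ "t 0" b]
        \<Lambda>(1) \<open>0 \<le> R\<close> b by (simp add: I_def)
    moreover have "?f \<theta> - ?f (\<Psi>, A, H, B) = lam b \<bullet> d b"
      using rom_flow_eq[OF w b] rom_flow_eq[OF z b] by (simp add: \<theta> d_def inner_diff_right)
    moreover have "d (t 0) = transpose (\<Psi>' - \<Psi>) *v x0"
      using w z by (simp add: d_def rom_solution_def matrix_vector_mult_simps
          linear_diff[OF bounded_linear.linear[OF bounded_linear_transpose]])
    ultimately show "norm (?f \<theta> - ?f (\<Psi>, A, H, B) - ?D (\<theta> - (\<Psi>, A, H, B)))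
        \<le> (\<Lambda> * R * (b - t 0)) * \<delta>\<^sup>2"
      unfolding \<delta>_def[symmetric] by (simp add: \<theta> p_def[abs_def] I_def diff_diff_eq mult_ac del: transpose_matrix_vector)
  qed
qed

text \<open>Every vector is the terminal value of some adjoint solution, so every scalar component
  of the state at time \<open>b\<close> is differentiable, and hence the state itself is. The
  pairing formula then holds for each adjoint solution by uniqueness of derivatives.\<close>

lemma rom_flow_has_derivative:
  fixes t :: "nat \<Rightarrow> real" and x0 :: "real^'n" and u :: "real \<Rightarrow> real^'m"
    and \<Psi> :: "real^'r^'n" and A :: "real^'r^'r" and H :: "real^'r^'r^'r" and B :: "real^'m^'r"
  assumes t: "t 0 \<le> t (N - 1)"
    and u: "continuous_on {t 0..t (N - 1)} u"
    and z: "rom_solution t N x0 u \<Psi> A H B z"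
    and b: "b \<in> {t 0..t (N - 1)}"
  obtains D where
    "((\<lambda>(\<Psi>', A', H', B'). rom_flow t N x0 u \<Psi>' A' H' B' b) has_derivative D) (at (\<Psi>, A, H, B))"
    and "\<And>lam d\<Psi> dA dH dB. rom_adjoint (t 0) b A H B u z lam \<Longrightarrow>
      lam b \<bullet> D (d\<Psi>, dA, dH, dB) = lam (t 0) \<bullet> (transpose d\<Psi> *v x0)
        + integral {t 0..b} (\<lambda>s. lam s \<bullet> rom_rhs dA dH dB (z s) (u s))"
proof -
  define f where "f = (\<lambda>(\<Psi>', A' :: real^'r^'r, H', B'). rom_flow t N x0 u \<Psi>' A' H' B' b)"
  have "continuous_on {t 0..b} z"
    using continuous_on_subset[OF rom_solution_continuous_on[OF z]] b by auto
  then have lam_ex: "\<exists>lam. rom_adjoint (t 0) b A H B u z lam \<and> lam b = l" for l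
    using rom_adjoint_exists[of "t 0" b z A H B u l] b by auto
  have f_inner: "(\<lambda>\<theta>. f \<theta> \<bullet> l)
      = (\<lambda>(\<Psi>', A', H', B'). l \<bullet> rom_flow t N x0 u \<Psi>' A' H' B' b)" for l
    by (auto simp: f_def inner_commute)
  have "\<exists>D. ((\<lambda>\<theta>. f \<theta> \<bullet> l) has_derivative D) (at (\<Psi>, A, H, B))" for l
  proof -
    obtain lam where lam: "rom_adjoint (t 0) b A H B u z lam" "lam b = l"
      using lam_ex by blast
    show ?thesis
      unfolding f_inner using rom_flow_adjoint_has_derivative[OF t u z b lam(1)] lam(2) by blast
  qed
  then obtain D' where D': "\<And>l. ((\<lambda>\<theta>. f \<theta> \<bullet> l) has_derivative D' l) (at (\<Psi>, A, H, B))"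
    by metis
  define D where "D \<theta> = (\<Sum>i\<in>Basis. D' i \<theta> *\<^sub>R i)" for \<theta>
  have D: "(f has_derivative D) (at (\<Psi>, A, H, B))"
    using D' by (subst has_derivative_componentwise_within)
      (simp add: D_def inner_sum_left_Basis)
  show ?thesis
  proof (rule that[OF D[unfolded f_def]])
    fix lam d\<Psi> dA dH dB assume lam: "rom_adjoint (t 0) b A H B u z lam"
    have "((\<lambda>\<theta>. lam b \<bullet> f \<theta>) has_derivative (\<lambda>\<theta>. lam b \<bullet> D \<theta>)) (at (\<Psi>, A, H, B))"
      by (rule has_derivative_inner_right[OF D])
    moreover have "(\<lambda>\<theta>. lam b \<bullet> f \<theta>)
        = (\<lambda>(\<Psi>', A', H', B'). lam b \<bullet> rom_flow t N x0 u \<Psi>' A' H' B' b)"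
      by (auto simp: f_def)
    ultimately have "(\<lambda>\<theta>. lam b \<bullet> D \<theta>) = (\<lambda>(d\<Psi>, dA, dH, dB). lam (t 0) \<bullet> (transpose d\<Psi> *v x0)
        + integral {t 0..b} (\<lambda>s. lam s \<bullet> rom_rhs dA dH dB (z s) (u s)))"
      using has_derivative_unique[OF _ rom_flow_adjoint_has_derivative[OF t u z b lam]] by simp
    from fun_cong[OF this, of "(d\<Psi>, dA, dH, dB)"]
    show "lam b \<bullet> D (d\<Psi>, dA, dH, dB) = lam (t 0) \<bullet> (transpose d\<Psi> *v x0)
        + integral {t 0..b} (\<lambda>s. lam s \<bullet> rom_rhs dA dH dB (z s) (u s))"
      by (simp only: prod.case)
  qed
qed

section \<open>The lifting map\<close>

lemma norm_matrix_mult_le: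
  fixes A :: "real^'n^'m" and B :: "real^'k^'n"
  shows "norm (A ** B) \<le> norm A * norm B"
proof (rule norm_vec_le_mult)
  fix i
  have "(A ** B) $ i = transpose B *v (A $ i)"
    by (simp add: vec_eq_iff matrix_matrix_mult_def vector_matrix_mult_def mult.commute)
  then show "norm ((A ** B) $ i) \<le> norm (A $ i) * norm B"
    using norm_matrix_vector_mult_le[of "transpose B" "A $ i"]
    by (simp add: mult.commute del: transpose_matrix_vector)
qed simp

lemma bounded_bilinear_matrix_mult:
  "bounded_bilinear ((**) :: real^'n^'m \<Rightarrow> real^'k^'n \<Rightarrow> real^'k^'m)"
  by (auto simp flip: bilinear_conv_bounded_bilinear simp: bilinear_def
      matrix_add_ldistrib matrix_scalar_ac scalar_matrix_assoc vec_eq_iff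
      matrix_matrix_mult_def sum.distrib algebra_simps sum_distrib_left intro!: linearI)

interpretation matrix_mult: bounded_bilinear "(**) :: real^'n^'m \<Rightarrow> real^'k^'n \<Rightarrow> real^'k^'m"
  by (rule bounded_bilinear_matrix_mult)

section \<open>Inverses of square matrices and their derivative\<close>

lemma matrix_inv_mult:
  fixes M :: "real^'n^'n"
  assumes "invertible M"
  shows "M ** matrix_inv M = mat 1" "matrix_inv M ** M = mat 1"
  using someI_ex[OF assms[unfolded invertible_def]] by (simp_all add: matrix_inv_def)

lemma matrix_inv_eq:
  fixes M :: "real^'n^'n"
  assumes "M ** P = mat 1"
  shows "matrix_inv M = P"
proof -
  have "invertible M" using assms by (auto simp: invertible_right_inverse)
  then show ?thesis
    by (metis assms matrix_inv_mult(2) matrix_mul_assoc matrix_mul_lid matrix_mul_rid)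
qed

lemma matrix_inv_transpose:
  fixes M :: "real^'n^'n"
  assumes "invertible M"
  shows "matrix_inv (transpose M) = transpose (matrix_inv M)"
  using matrix_inv_mult(2)[OF assms]
  by (intro matrix_inv_eq) (simp flip: matrix_transpose_mul add: transpose_mat)

text \<open>With \<open>P\<close> the perturbed inverse and \<open>D\<close> the increment, the
  identity \<open>P = Q - P ** D ** Q\<close> used twice leaves the remainder
  \<open>P ** D ** Q ** D ** Q\<close>, which is quadratic in \<open>D\<close> once \<open>P\<close>
  is bounded.\<close>

lemma has_derivative_matrix_inv:
  fixes M :: "real^'n^'n"
  assumes M: "invertible M"
  shows "(matrix_inv has_derivative (\<lambda>D. - (matrix_inv M ** D ** matrix_inv M))) (at M)"
proof -
  define Q where "Q = matrix_inv M"
  \<comment> \<open>This radius forces norm D * norm Q \<le> 1/2, which yields both invertibility of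
    the perturbed matrix and norm P \<le> 2 * norm Q. Adding 1 keeps the denominator
    positive.\<close>
  define \<epsilon> where "\<epsilon> = 1 / (2 * (norm Q + 1))"
  have MQ: "M ** Q = mat 1" "Q ** M = mat 1" using matrix_inv_mult[OF M] by (simp_all add: Q_def)
  have "0 < norm Q + 1" by (simp add: add_nonneg_pos)
  then have "0 < \<epsilon>" by (simp add: \<epsilon>_def)
  have "(matrix_inv has_derivative (\<lambda>D. - (Q ** D ** Q))) (at M)"
  proof (rule has_derivative_quadratic_remainder[OF _ \<open>0 < \<epsilon>\<close>])
    show "bounded_linear (\<lambda>D. - (Q ** D ** Q))"
      by (intro bounded_linear_minus bounded_linear_compose[OF matrix_mult.bounded_linear_left]
          matrix_mult.bounded_linear_right)
    fix M' assume "dist M' M < \<epsilon>"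
    define D where "D = M' - M"
    define P where "P = matrix_inv M'"
    have M': "M' = M + D" by (simp add: D_def)
    have "norm D * (2 * (norm Q + 1)) < 1"
      using \<open>dist M' M < \<epsilon>\<close> \<open>0 < norm Q + 1\<close>
      by (simp add: D_def dist_norm \<epsilon>_def pos_less_divide_eq)
    then have small: "norm D * norm Q \<le> 1/2"
      by (simp add: algebra_simps) (smt (verit) norm_ge_zero)
    have "x = 0" if "M' *v x = 0" for x
    proof -
      have "x = Q *v (M *v x)" by (simp add: matrix_vector_mul_assoc MQ)
      also have "M *v x = - (D *v x)" using that by (simp add: M' matrix_vector_mult_simps eq_neg_iff_add_eq_0)
      finally have "norm x = norm (Q *v (D *v x))"
        by (metis norm_minus_cancel vec.neg)
      also have "\<dots> \<le> norm Q * (norm D * norm x)"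
        by (rule order_trans[OF norm_matrix_vector_mult_le])
          (simp add: mult_left_mono norm_matrix_vector_mult_le)
      also have "\<dots> \<le> 1/2 * norm x"
        using mult_right_mono[OF small, of "norm x"] by (simp add: mult_ac)
      finally show "x = 0" by simp
    qed
    then have "invertible M'"
      by (metis matrix_left_invertible_ker invertible_left_inverse)
    then have PM': "P ** M' = mat 1" by (simp add: P_def matrix_inv_mult)
    have "P ** (M ** Q) = P ** ((M' - D) ** Q)" by (simp add: M')
    then have P: "P = Q - P ** D ** Q"
      by (simp add: MQ matrix_mult.diff_left matrix_mult.diff_right matrix_mul_assoc PM')
    have "norm P \<le> norm Q + norm (P ** D ** Q)"
      by (metis P norm_triangle_ineq4)
    also have "norm (P ** D ** Q) \<le> norm P * norm D * norm Q"
      by (rule order_trans[OF norm_matrix_mult_le])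
        (simp add: mult_right_mono norm_matrix_mult_le)
    also have "\<dots> \<le> norm P * (1/2)"
      using mult_left_mono[OF small, of "norm P"] by (simp add: mult.assoc)
    finally have P_le: "norm P \<le> 2 * norm Q" by simp
    have "P - Q - - (Q ** D ** Q) = (Q - P) ** D ** Q"
      by (subst P) (simp add: matrix_mult.diff_left)
    also have "Q - P = P ** D ** Q" using P by (metis add_diff_cancel_left' diff_add_cancel)
    also have "norm (P ** D ** Q ** D ** Q) \<le> norm P * norm D * norm Q * norm D * norm Q"
      by (intro order_trans[OF norm_matrix_mult_le] mult_right_mono) simp_all
    also have "\<dots> \<le> 2 * norm Q * norm D * norm Q * norm D * norm Q"
      by (intro mult_right_mono P_le) simp_all
    finally show "norm (matrix_inv M' - matrix_inv M - - (Q ** (M' - M) ** Q))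
        \<le> (2 * norm Q ^ 3) * (dist M' M)\<^sup>2"
      by (simp add: P_def Q_def D_def dist_norm power2_eq_square power3_eq_cube mult_ac)
  qed
  then show ?thesis by (simp add: Q_def)
qed

text \<open>The first matrix of the lifting occurs both outside and inside the inverse. Its two
  contributions combine into the oblique projection
  \<open>mat 1 - F x ** Q ** transpose (G x)\<close>.\<close>

lemma has_derivative_lift:
  fixes F G :: "'a::real_normed_vector \<Rightarrow> real^'r^'n" and Z :: "'a \<Rightarrow> real^'r"
  assumes F: "(F has_derivative F') (at x)" and G: "(G has_derivative G') (at x)"
    and Z: "(Z has_derivative Z') (at x)"
    and inv: "invertible (transpose (G x) ** F x)"
  defines "Q \<equiv> matrix_inv (transpose (G x) ** F x)"
  shows "((\<lambda>x. lift (F x) (G x) (Z x)) has_derivative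
    (\<lambda>d. (mat 1 - F x ** Q ** transpose (G x)) *v (F' d *v (Q *v Z x))
      - (F x ** Q) *v (transpose (G' d) *v ((F x ** Q) *v Z x)) + (F x ** Q) *v Z' d)) (at x)"
proof -
  have "((\<lambda>x. transpose (G x) ** F x) has_derivative
      (\<lambda>d. transpose (G x) ** F' d + transpose (G' d) ** F x)) (at x)"
    by (rule matrix_mult.FDERIV[OF bounded_linear.has_derivative[OF bounded_linear_transpose G] F])
  then have "((\<lambda>x. matrix_inv (transpose (G x) ** F x)) has_derivative
      (\<lambda>d. - (Q ** (transpose (G x) ** F' d + transpose (G' d) ** F x) ** Q))) (at x)"
    using has_derivative_compose[where f = "\<lambda>x. transpose (G x) ** F x" and g = matrix_inv,
        OF _ has_derivative_matrix_inv[OF inv]]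
    unfolding Q_def by blast
  note bounded_bilinear.FDERIV[OF bounded_bilinear_matrix_vector_mult matrix_mult.FDERIV[OF F this] Z]
  then show ?thesis
    unfolding lift_def Q_def[symmetric]
    by (rule has_derivative_eq_rhs) (rule ext,
      simp add: matrix_vector_mult_simps matrix_mult.add_right matrix_mult.add_left
        matrix_mult.minus_right matrix_vector_mul_assoc matrix_mul_assoc matrix_mult.diff_left matrix_mult.diff_right
        bounded_bilinear.minus_left[OF bounded_bilinear_matrix_vector_mult]
        del: transpose_matrix_vector)
qed

lemma has_derivative_squared_error:
  fixes h :: "real^'n \<Rightarrow> real^'p" and y :: "real^'p"
  assumes g: "(g has_derivative g') (at x)" and h: "h differentiable (at (g x))"
  shows "((\<lambda>x. (norm (y - h (g x)))\<^sup>2) has_derivative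
    (\<lambda>d. - 2 * ((y - h (g x)) \<bullet> (jacobian h (at (g x)) *v g' d)))) (at x)"
proof -
  have "((\<lambda>x. h (g x)) has_derivative (\<lambda>d. jacobian h (at (g x)) *v g' d)) (at x)"
    using has_derivative_compose[OF g] h by (simp add: jacobian_works)
  then have "((\<lambda>x. y - h (g x)) has_derivative (\<lambda>d. - (jacobian h (at (g x)) *v g' d))) (at x)"
    by (auto intro!: derivative_eq_intros)
  from has_derivative_inner[OF this this] show ?thesis
    unfolding power2_norm_eq_inner by (rule has_derivative_eq_rhs) (simp add: inner_commute)
qed

section \<open>Gradients of the cost\<close>

lemma inner_matrix_vector_mult:
  fixes A :: "real^'n^'m"
  shows "x \<bullet> (A *v y) = (transpose A *v x) \<bullet> y"
  by (simp add: dot_lmul_matrix)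

lemma matrix_mult_outer: "M ** outer a b = outer (M *v a) b"
  by (simp add: outer_def vec_eq_iff matrix_matrix_mult_def matrix_vector_mult_def
      sum_distrib_right mult.assoc)

lemma outer_matrix_mult: "outer a b ** M = outer a (transpose M *v b)"
  by (simp add: outer_def vec_eq_iff matrix_matrix_mult_def vector_matrix_mult_def
      sum_distrib_left mult_ac)

text \<open>This identity and the next one give the representers: a scalar linear in a matrix or
  tensor parameter becomes an entrywise inner product, from which the gradient is read off.\<close>

lemma inner_outer: "X \<bullet> outer a b = a \<bullet> (X *v b)"
  by (simp add: outer_def inner_vec_def matrix_vector_mult_def sum_distrib_left mult_ac)

lemma inner_tensor_outer: "H \<bullet> tensor_outer l z = l \<bullet> tensor_quad H z"
  by (simp add: tensor_outer_def tensor_quad_def inner_vec_def sum_distrib_left mult_ac)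

text \<open>The terminal value of \<open>lam\<close> is minus the gradient of the squared error in
  the state. The effect through the trajectory is therefore minus the pairing of
  \<open>lam (t i)\<close> with the state derivative, which the adjoint formula evaluates; the rest
  is the direct effect of the lifting.\<close>

lemma output_error_squared_has_derivative:
  fixes t :: "nat \<Rightarrow> real" and x0 :: "real^'n" and y :: "nat \<Rightarrow> real^'p"
    and u :: "real \<Rightarrow> real^'m" and h :: "real^'n \<Rightarrow> real^'p"
    and \<Phi> \<Psi> :: "real^'r^'n"
    and A :: "real^'r^'r" and H :: "real^'r^'r^'r" and B :: "real^'m^'r"
  assumes t: "t 0 \<le> t (N - 1)" and ti: "t i \<in> {t 0..t (N - 1)}"
    and u: "continuous_on {t 0..t (N - 1)} u"
    and h: "\<And>x. h differentiable (at x)"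
    and inv: "invertible (transpose \<Psi> ** \<Phi>)"
    and z: "rom_solution t N x0 u \<Psi> A H B z"
    and lam: "rom_adjoint (t 0) (t i) A H B u z lam"
  defines "e \<equiv> output_error t y h \<Phi> \<Psi> z i" and "C \<equiv> output_jacobian t h \<Phi> \<Psi> z i"
  assumes lam_end: "lam (t i) = 2 *\<^sub>R ((matrix_inv (transpose \<Phi> ** \<Psi>) ** transpose \<Phi>
      ** transpose C) *v e)"
  shows "((\<lambda>(\<Phi>', \<Psi>', A', H', B'). (norm (output_error t y h \<Phi>' \<Psi>' (rom_flow t N x0 u \<Psi>' A' H' B') i))\<^sup>2)
    has_derivative (\<lambda>(d\<Phi>, d\<Psi>, dA, dH, dB).
      - 2 * (d\<Phi> \<bullet> ((mat 1 - \<Psi> ** matrix_inv (transpose \<Phi> ** \<Psi>) ** transpose \<Phi>)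
          ** transpose C ** outer e (z (t i)) ** matrix_inv (transpose \<Phi> ** \<Psi>)))
      + d\<Psi> \<bullet> (2 *\<^sub>R (\<Phi> ** matrix_inv (transpose \<Psi> ** \<Phi>) ** outer (z (t i)) e
          ** C ** \<Phi> ** matrix_inv (transpose \<Psi> ** \<Phi>)) - outer x0 (lam (t 0)))
      - integral {t 0..t i} (\<lambda>s. lam s \<bullet> rom_rhs dA dH dB (z s) (u s)))) (at (\<Phi>, \<Psi>, A, H, B))"
proof -
  define Q where "Q = matrix_inv (transpose \<Psi> ** \<Phi>)"
  have QT: "matrix_inv (transpose \<Phi> ** \<Psi>) = transpose Q"
    using matrix_inv_transpose[OF inv] by (simp add: Q_def matrix_transpose_mul)
  define \<theta> where "\<theta> = (\<Phi>, \<Psi>, A, H, B)"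
  define Z where "Z = (\<lambda>(\<Psi>', A' :: real^'r^'r, H', B'). rom_flow t N x0 u (\<Psi>' :: real^'r^'n) A' H' B' (t i))"
  obtain D where D: "(Z has_derivative D) (at (\<Psi>, A, H, B))"
    and D_lam: "\<And>d\<Psi> dA dH dB. lam (t i) \<bullet> D (d\<Psi>, dA, dH, dB) = lam (t 0) \<bullet> (transpose d\<Psi> *v x0)
        + integral {t 0..t i} (\<lambda>s. lam s \<bullet> rom_rhs dA dH dB (z s) (u s))"
    by (rule rom_flow_has_derivative[OF t u z ti, folded Z_def]) (use lam in blast)
  have Z: "Z (\<Psi>, A, H, B) = z (t i)" using rom_flow_eq[OF z ti] by (simp add: Z_def)
  \<comment> \<open>The trajectory does not depend on \<Phi>, so its derivative is pulled back along
    the projection that forgets \<Phi>.\<close>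
  have snd_deriv: "(snd has_derivative snd) (at \<theta>)"
    by (rule bounded_linear.has_derivative[OF bounded_linear_snd has_derivative_ident])
  have "((\<lambda>p. Z (snd p)) has_derivative (\<lambda>d. D (snd d))) (at \<theta>)"
    using D by (intro has_derivative_compose[OF snd_deriv, where g = Z and g' = D])
      (simp add: \<theta>_def)
  moreover have "(fst has_derivative fst) (at \<theta>)"
    by (rule bounded_linear.has_derivative[OF bounded_linear_fst has_derivative_ident])
  moreover have "((\<lambda>p. fst (snd p)) has_derivative (\<lambda>d. fst (snd d))) (at \<theta>)"
    by (rule bounded_linear.has_derivative[OF bounded_linear_fst snd_deriv])
  ultimately have "((\<lambda>p. lift (fst p) (fst (snd p)) (Z (snd p))) has_derivative
      (\<lambda>d. (mat 1 - \<Phi> ** Q ** transpose \<Psi>) *v (fst d *v (Q *v z (t i)))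
      - (\<Phi> ** Q) *v (transpose (fst (snd d)) *v ((\<Phi> ** Q) *v z (t i)))
      + (\<Phi> ** Q) *v D (snd d))) (at \<theta>)"
    using has_derivative_lift[of fst fst \<theta> "\<lambda>p. fst (snd p)" "\<lambda>d. fst (snd d)"
        "\<lambda>p. Z (snd p)" "\<lambda>d. D (snd d)"] inv
    by (simp add: \<theta>_def Q_def Z del: transpose_matrix_vector)
  from has_derivative_squared_error[OF this h, of "y i"]
  have "((\<lambda>p. (norm (y i - h (lift (fst p) (fst (snd p)) (Z (snd p)))))\<^sup>2) has_derivative
      (\<lambda>d. - 2 * (e \<bullet> (C *v ((mat 1 - \<Phi> ** Q ** transpose \<Psi>) *v (fst d *v (Q *v z (t i)))
      - (\<Phi> ** Q) *v (transpose (fst (snd d)) *v ((\<Phi> ** Q) *v z (t i)))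
      + (\<Phi> ** Q) *v D (snd d)))))) (at \<theta>)"
    by (simp add: \<theta>_def Z e_def C_def output_error_def output_jacobian_def del: transpose_matrix_vector)
  note deriv = this
  \<comment> \<open>\<open>a\<close> is the error pulled back to the full state space, and
    \<open>c\<close> is its pullback to the reduced space, half the terminal multiplier.\<close>
  define P where "P = \<Phi> ** Q"
  define a where "a = transpose C *v e"
  define c where "c = transpose P *v a"
  have fn: "(\<lambda>(\<Phi>', \<Psi>', A', H', B'). (norm (output_error t y h \<Phi>' \<Psi>' (rom_flow t N x0 u \<Psi>' A' H' B') i))\<^sup>2)
      = (\<lambda>p. (norm (y i - h (lift (fst p) (fst (snd p)) (Z (snd p)))))\<^sup>2)"
    by (auto simp: Z_def output_error_def)
  have lam_c: "lam (t i) = 2 *\<^sub>R c"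
    by (simp add: lam_end QT c_def a_def P_def matrix_transpose_mul matrix_vector_mul_assoc
        del: transpose_matrix_vector)
  have "transpose (mat 1 - P ** transpose \<Psi>) = mat 1 - \<Psi> ** transpose Q ** transpose \<Phi>"
    by (simp add: linear_diff[OF bounded_linear.linear[OF bounded_linear_transpose]] transpose_mat
        P_def matrix_transpose_mul matrix_mul_assoc)
  then have grad_\<Phi>: "a \<bullet> ((mat 1 - P ** transpose \<Psi>) *v (d\<Phi> *v (Q *v z (t i))))
      = d\<Phi> \<bullet> ((mat 1 - \<Psi> ** transpose Q ** transpose \<Phi>) ** transpose C ** outer e (z (t i)) ** transpose Q)" for d\<Phi>
    by (simp add: inner_matrix_vector_mult[of "transpose C *v e" "mat 1 - P ** transpose \<Psi>"] matrix_mult_outer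
        outer_matrix_mult inner_outer a_def del: transpose_matrix_vector flip: matrix_vector_mul_assoc)
  have "a \<bullet> (P *v (transpose d\<Psi> *v (P *v z (t i)))) = (d\<Psi> *v c) \<bullet> (P *v z (t i))" for d\<Psi>
    by (simp add: inner_matrix_vector_mult[of a P] inner_matrix_vector_mult[of c "transpose d\<Psi>"] c_def[symmetric]
        del: transpose_matrix_vector)
  moreover have "\<Phi> ** Q ** outer (z (t i)) e ** C ** \<Phi> ** Q = outer (P *v z (t i)) c"
    by (simp add: outer_matrix_mult matrix_mult_outer c_def a_def P_def matrix_transpose_mul
        matrix_vector_mul_assoc matrix_mul_assoc del: transpose_matrix_vector)
  ultimately have grad_\<Psi>: "a \<bullet> (P *v (transpose d\<Psi> *v (P *v z (t i))))
      = d\<Psi> \<bullet> (\<Phi> ** Q ** outer (z (t i)) e ** C ** \<Phi> ** Q)" for d\<Psi>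
    by (simp add: inner_outer inner_commute)
  have "c \<bullet> D \<delta> = (lam (t i) \<bullet> D \<delta>) / 2" for \<delta>
    by (simp add: lam_c)
  then have grad_z: "a \<bullet> (P *v D (d\<Psi>, dA, dH, dB)) = (d\<Psi> \<bullet> outer x0 (lam (t 0))
      + integral {t 0..t i} (\<lambda>s. lam s \<bullet> rom_rhs dA dH dB (z s) (u s))) / 2" for d\<Psi> dA dH dB
    by (simp add: inner_matrix_vector_mult[of a P] c_def[symmetric] D_lam inner_outer
        inner_matrix_vector_mult[of x0 d\<Psi>] inner_commute del: transpose_matrix_vector)
  show ?thesis
    unfolding fn \<theta>_def[symmetric]
  proof (rule has_derivative_eq_rhs[OF deriv], rule ext)
    fix d :: "(real^'r^'n) \<times> (real^'r^'n) \<times> (real^'r^'r) \<times> (real^'r^'r^'r) \<times> (real^'m^'r)"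
    obtain d\<Phi> d\<Psi> dA dH dB where d: "d = (d\<Phi>, d\<Psi>, dA, dH, dB)" by (metis prod_cases5)
    have e_C: "e \<bullet> (C *v w) = a \<bullet> w" for w
      by (simp add: inner_matrix_vector_mult a_def del: transpose_matrix_vector)
    \<comment> \<open>Here \<open>b\<close> is the direct effect of \<Psi> through the lifting,
      \<open>c\<close> its effect through the initial value, and \<open>d\<close> the integral for
      the operators. The halves come from \<open>lam_c\<close>.\<close>
    have collect: "- 2 * (a - b + (c + d) / 2) = - 2 * a + (2 * b - c) - d" for a b c d :: real
      by (simp add: field_simps)
    show "- 2 * (e \<bullet> (C *v ((mat 1 - \<Phi> ** Q ** transpose \<Psi>) *v (fst d *v (Q *v z (t i)))
        - (\<Phi> ** Q) *v (transpose (fst (snd d)) *v ((\<Phi> ** Q) *v z (t i)))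
        + (\<Phi> ** Q) *v D (snd d))))
      = (case d of (d\<Phi>, d\<Psi>, dA, dH, dB) \<Rightarrow>
      - 2 * (d\<Phi> \<bullet> ((mat 1 - \<Psi> ** matrix_inv (transpose \<Phi> ** \<Psi>) ** transpose \<Phi>)
          ** transpose C ** outer e (z (t i)) ** matrix_inv (transpose \<Phi> ** \<Psi>)))
      + d\<Psi> \<bullet> (2 *\<^sub>R (\<Phi> ** matrix_inv (transpose \<Psi> ** \<Phi>) ** outer (z (t i)) e
          ** C ** \<Phi> ** matrix_inv (transpose \<Psi> ** \<Phi>)) - outer x0 (lam (t 0)))
      - integral {t 0..t i} (\<lambda>s. lam s \<bullet> rom_rhs dA dH dB (z s) (u s)))"
      unfolding d prod.case fst_conv snd_conv QT Q_def[symmetric] P_def[symmetric]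
      by (simp only: e_C inner_add_right inner_diff_right inner_scaleR_right grad_\<Phi> grad_z
          grad_\<Psi>[unfolded P_def] grad_\<Psi> P_def[symmetric] collect)
  qed
qed


section \<open>Agreement of Lagrangian and cost wherever a trajectory exists\<close>

lemma reduced_lagrangian_eq_reduced_cost:
  assumes t: "\<And>i. i < N \<Longrightarrow> t i \<in> {t 0..t (N - 1)}"
    and ex: "\<exists>w. rom_solution t N x0 u \<Psi> A H B w"
  shows "reduced_lagrangian t N x0 y u h lam \<Phi> \<Psi> A H B = reduced_cost t N x0 y u h \<Phi> \<Psi> A H B"
proof -
  define w where "w = rom_flow t N x0 u \<Psi> A H B"
  have w: "rom_solution t N x0 u \<Psi> A H B w"
    using someI_ex[OF ex] by (simp add: w_def rom_flow_def)
  have "integral {t 0..t i} (\<lambda>s. lam i s \<bullet>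
      (vector_derivative w (at s within {t 0..t (N - 1)})
        - A *v w s - tensor_quad H (w s) - B *v u s)) = 0" if i: "i < N" for i
  \<comment> \<open>On a one-point time interval \<open>vector_derivative\<close> is not determined
    by the equation, but the integral over a point vanishes. Otherwise the interval is nondegenerate
    and the residual is zero, whatever the multiplier.\<close>
  proof (cases "t 0 = t i")
    case False
    then have "t 0 < t (N - 1)" "{t 0..t i} \<subseteq> {t 0..t (N - 1)}" using t[OF i] by auto
    then have "vector_derivative w (at s within {t 0..t (N - 1)}) = rom_rhs A H B (w s) (u s)"
      if "s \<in> {t 0..t i}" for s
      using w that by (intro vector_derivative_within_closed_interval) (auto simp: rom_solution_def)
    then have "vector_derivative w (at s within {t 0..t (N - 1)})
        - A *v w s - tensor_quad H (w s) - B *v u s = 0" if "s \<in> {t 0..t i}" for s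
      using that by (simp add: rom_rhs_def)
    then have "lam i s \<bullet> (vector_derivative w (at s within {t 0..t (N - 1)})
        - A *v w s - tensor_quad H (w s) - B *v u s) = 0" if "s \<in> {t 0..t i}" for s
      using that by (simp only: inner_zero_right)
    then have "integral {t 0..t i} (\<lambda>s. lam i s \<bullet>
      (vector_derivative w (at s within {t 0..t (N - 1)})
        - A *v w s - tensor_quad H (w s) - B *v u s)) = integral {t 0..t i} (\<lambda>_. 0)"
      by (rule integral_cong)
    then show ?thesis by simp
  qed simp
  then show ?thesis
    using w by (simp add: reduced_lagrangian_def reduced_cost_def lagrangian_def cost_def
        w_def[symmetric] rom_solution_def)
qed

lemma eventually_rom_solution_exists:
  fixes t :: "nat \<Rightarrow> real"
  assumes "t 0 \<le> t (N - 1)" "continuous_on {t 0..t (N - 1)} u" "rom_solution t N x0 u \<Psi> A H B z"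
  shows "\<forall>\<^sub>F (\<Psi>', A', H', B') in nhds (\<Psi>, A, H, B). \<exists>w. rom_solution t N x0 u \<Psi>' A' H' B' w"
proof -
  obtain \<epsilon> where "0 < \<epsilon>" and
    "\<And>\<Psi>' A' H' B'. dist (\<Psi>', A', H', B') (\<Psi>, A, H, B) < \<epsilon> \<Longrightarrow>
      \<exists>w. rom_solution t N x0 u \<Psi>' A' H' B' w"
    by (rule rom_solution_perturb[OF assms]) blast
  then show ?thesis
    unfolding eventually_nhds_metric by auto
qed

section \<open>From the joint derivative to the five gradients\<close>

lemma partial_gradients:
  fixes F :: "'a::real_inner \<Rightarrow> 'b::real_inner \<Rightarrow> 'c::real_inner \<Rightarrow> 'd::real_inner \<Rightarrow> 'e::real_inner \<Rightarrow> real"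
  assumes "((\<lambda>(a, b, c, d, e). F a b c d e) has_derivative
      (\<lambda>(a, b, c, d, e). a \<bullet> a' + b \<bullet> b' + c \<bullet> c' + d \<bullet> d' + e \<bullet> e')) (at (a, b, c, d, e))"
  shows "GDERIV (\<lambda>x. F x b c d e) a :> a'" "GDERIV (\<lambda>x. F a x c d e) b :> b'"
    "GDERIV (\<lambda>x. F a b x d e) c :> c'" "GDERIV (\<lambda>x. F a b c x e) d :> d'"
    "GDERIV (\<lambda>x. F a b c d x) e :> e'"
proof -
  \<comment> \<open>The chain rule along an affine embedding of one parameter with the other four
    fixed; its derivative inserts zeros in their places.\<close>
  have *: "((\<lambda>x. (\<lambda>(a, b, c, d, e). F a b c d e) (g x)) has_derivative
      (\<lambda>x. (\<lambda>(a, b, c, d, e). a \<bullet> a' + b \<bullet> b' + c \<bullet> c' + d \<bullet> d' + e \<bullet> e') (g' x))) (at x)"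
    if "(g has_derivative g') (at x)" "g x = (a, b, c, d, e)" for g g' x
    by (rule has_derivative_compose[OF that(1)]) (use assms that(2) in simp)
  show "GDERIV (\<lambda>x. F x b c d e) a :> a'"
    using *[of "\<lambda>x. (x, b, c, d, e)" "\<lambda>x. (x, 0, 0, 0, 0)" a]
    by (simp add: gderiv_def has_derivative_Pair)
  show "GDERIV (\<lambda>x. F a x c d e) b :> b'"
    using *[of "\<lambda>x. (a, x, c, d, e)" "\<lambda>x. (0, x, 0, 0, 0)" b]
    by (simp add: gderiv_def has_derivative_Pair)
  show "GDERIV (\<lambda>x. F a b x d e) c :> c'"
    using *[of "\<lambda>x. (a, b, x, d, e)" "\<lambda>x. (0, 0, x, 0, 0)" c]
    by (simp add: gderiv_def has_derivative_Pair)
  show "GDERIV (\<lambda>x. F a b c x e) d :> d'"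
    using *[of "\<lambda>x. (a, b, c, x, e)" "\<lambda>x. (0, 0, 0, x, 0)" d]
    by (simp add: gderiv_def has_derivative_Pair)
  show "GDERIV (\<lambda>x. F a b c d x) e :> e'"
    using *[of "\<lambda>x. (a, b, c, d, x)" "\<lambda>x. (0, 0, 0, 0, x)" e]
    by (simp add: gderiv_def has_derivative_Pair)
qed

lemma continuous_on_outer:
  assumes "continuous_on S f" "continuous_on S g"
  shows "continuous_on S (\<lambda>s. outer (f s) (g s))"
  unfolding outer_def by (intro continuous_on_vec_lambda continuous_intros assms)

lemma continuous_on_tensor_outer:
  assumes "continuous_on S f" "continuous_on S g"
  shows "continuous_on S (\<lambda>s. tensor_outer (f s) (g s))"
  unfolding tensor_outer_def by (intro continuous_on_vec_lambda continuous_intros assms)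

text \<open>Linearity of the dynamics in the operators lets the constant increments be pulled out of
  the integral, leaving the matrix and tensor integrals of the gradient formulas.\<close>

lemma integral_inner_rom_rhs:
  fixes lam z :: "real \<Rightarrow> real^'r" and u :: "real \<Rightarrow> real^'m"
  assumes "continuous_on {a..b} lam" "continuous_on {a..b} z" "continuous_on {a..b} u"
  shows "integral {a..b} (\<lambda>s. lam s \<bullet> rom_rhs A H B (z s) (u s))
    = A \<bullet> integral {a..b} (\<lambda>s. outer (lam s) (z s))
      + H \<bullet> integral {a..b} (\<lambda>s. tensor_outer (lam s) (z s))
      + B \<bullet> integral {a..b} (\<lambda>s. outer (lam s) (u s))"
proof -
  have A: "(\<lambda>s. outer (lam s) (z s)) integrable_on {a..b}"
    and H: "(\<lambda>s. tensor_outer (lam s) (z s)) integrable_on {a..b}"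
    and B: "(\<lambda>s. outer (lam s) (u s)) integrable_on {a..b}"
    using assms by (auto intro!: integrable_continuous_real continuous_on_outer continuous_on_tensor_outer)
  have inner: "integral {a..b} (\<lambda>s. X \<bullet> f s) = X \<bullet> integral {a..b} f \<and> (\<lambda>s. X \<bullet> f s) integrable_on {a..b}"
    if "f integrable_on {a..b}" for X :: "'b::euclidean_space" and f
    using integral_linear[OF that bounded_linear_inner_right[of X]]
      integrable_linear[OF that bounded_linear_inner_right[of X]] by (simp add: o_def)
  have "(\<lambda>s. lam s \<bullet> rom_rhs A H B (z s) (u s)) = (\<lambda>s. A \<bullet> outer (lam s) (z s)
      + H \<bullet> tensor_outer (lam s) (z s) + B \<bullet> outer (lam s) (u s))"
    by (simp add: rom_rhs_def inner_add_right inner_outer inner_tensor_outer)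
  then show ?thesis
    using inner[OF A, of A] inner[OF H, of H] inner[OF B, of B]
    by (simp add: integral_add integrable_add)
qed

lemma reduced_cost_has_derivative:
  fixes t :: "nat \<Rightarrow> real" and x0 :: "real^'n" and y :: "nat \<Rightarrow> real^'p"
    and u :: "real \<Rightarrow> real^'m" and h :: "real^'n \<Rightarrow> real^'p"
    and \<Phi> \<Psi> :: "real^'r^'n"
    and A :: "real^'r^'r" and H :: "real^'r^'r^'r" and B :: "real^'m^'r"
  assumes t: "t 0 \<le> t (N - 1)" and ti: "\<And>i. i < N \<Longrightarrow> t i \<in> {t 0..t (N - 1)}"
    and u: "continuous_on {t 0..t (N - 1)} u"
    and h: "\<And>x. h differentiable (at x)"
    and inv: "invertible (transpose \<Psi> ** \<Phi>)"
    and z: "rom_solution t N x0 u \<Psi> A H B z"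
    and lam: "adjoint_solution t N y u h \<Phi> \<Psi> A H B z lam"
  defines "e \<equiv> output_error t y h \<Phi> \<Psi> z" and "C \<equiv> output_jacobian t h \<Phi> \<Psi> z"
  shows "((\<lambda>(\<Phi>', \<Psi>', A', H', B'). reduced_cost t N x0 y u h \<Phi>' \<Psi>' A' H' B') has_derivative
      (\<lambda>(d\<Phi>, d\<Psi>, dA, dH, dB).
        d\<Phi> \<bullet> (- 2 *\<^sub>R (\<Sum>i<N. (mat 1 - \<Psi> ** matrix_inv (transpose \<Phi> ** \<Psi>) ** transpose \<Phi>)
            ** transpose (C i) ** outer (e i) (z (t i)) ** matrix_inv (transpose \<Phi> ** \<Psi>)))
      + d\<Psi> \<bullet> (\<Sum>i<N. 2 *\<^sub>R (\<Phi> ** matrix_inv (transpose \<Psi> ** \<Phi>) ** outer (z (t i)) (e i)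
            ** C i ** \<Phi> ** matrix_inv (transpose \<Psi> ** \<Phi>)) - outer x0 (lam i (t 0)))
      + dA \<bullet> (- (\<Sum>i<N. integral {t 0..t i} (\<lambda>s. outer (lam i s) (z s))))
      + dH \<bullet> (- (\<Sum>i<N. integral {t 0..t i} (\<lambda>s. tensor_outer (lam i s) (z s))))
      + dB \<bullet> (- (\<Sum>i<N. integral {t 0..t i} (\<lambda>s. outer (lam i s) (u s)))))) (at (\<Phi>, \<Psi>, A, H, B))"
proof -
  have adj: "rom_adjoint (t 0) (t i) A H B u z (lam i)" if "i < N" for i
    using lam that unfolding adjoint_solution_def rom_adjoint_def by blast
  have int: "integral {t 0..t i} (\<lambda>s. lam i s \<bullet> rom_rhs dA dH dB (z s) (u s))
    = dA \<bullet> integral {t 0..t i} (\<lambda>s. outer (lam i s) (z s))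
      + dH \<bullet> integral {t 0..t i} (\<lambda>s. tensor_outer (lam i s) (z s))
      + dB \<bullet> integral {t 0..t i} (\<lambda>s. outer (lam i s) (u s))" if i: "i < N" for i dA dH dB
    by (rule integral_inner_rom_rhs[OF rom_adjoint_continuous_on[OF adj[OF i]]
          continuous_on_subset[OF rom_solution_continuous_on[OF z]] continuous_on_subset[OF u]])
      (use ti[OF i] in auto)
  have "((\<lambda>p. \<Sum>i<N. (\<lambda>(\<Phi>', \<Psi>', A', H', B').
      (norm (output_error t y h \<Phi>' \<Psi>' (rom_flow t N x0 u \<Psi>' A' H' B') i))\<^sup>2) p) has_derivative
    (\<lambda>p. \<Sum>i<N. (\<lambda>(d\<Phi>, d\<Psi>, dA, dH, dB).
      - 2 * (d\<Phi> \<bullet> ((mat 1 - \<Psi> ** matrix_inv (transpose \<Phi> ** \<Psi>) ** transpose \<Phi>)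
          ** transpose (C i) ** outer (e i) (z (t i)) ** matrix_inv (transpose \<Phi> ** \<Psi>)))
      + d\<Psi> \<bullet> (2 *\<^sub>R (\<Phi> ** matrix_inv (transpose \<Psi> ** \<Phi>) ** outer (z (t i)) (e i)
          ** C i ** \<Phi> ** matrix_inv (transpose \<Psi> ** \<Phi>)) - outer x0 (lam i (t 0)))
      - integral {t 0..t i} (\<lambda>s. lam i s \<bullet> rom_rhs dA dH dB (z s) (u s))) p)) (at (\<Phi>, \<Psi>, A, H, B))"
    unfolding e_def C_def
  proof (rule has_derivative_sum, rule output_error_squared_has_derivative[OF t ti u h inv z adj])
    fix i assume "i \<in> {..<N}"
    then show "i < N" "i < N"
      and "lam i (t i) = 2 *\<^sub>R ((matrix_inv (transpose \<Phi> ** \<Psi>) ** transpose \<Phi>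
          ** transpose (output_jacobian t h \<Phi> \<Psi> z i)) *v output_error t y h \<Phi> \<Psi> z i)"
      using lam unfolding adjoint_solution_def by auto
  qed
  note deriv = this
  have fn: "(\<lambda>(\<Phi>', \<Psi>', A', H', B'). reduced_cost t N x0 y u h \<Phi>' \<Psi>' A' H' B')
    = (\<lambda>p. \<Sum>i<N. (\<lambda>(\<Phi>', \<Psi>', A', H', B').
      (norm (output_error t y h \<Phi>' \<Psi>' (rom_flow t N x0 u \<Psi>' A' H' B') i))\<^sup>2) p)"
    by (auto simp: reduced_cost_def cost_def)
  show ?thesis
    unfolding fn
  proof (rule has_derivative_eq_rhs[OF deriv], rule ext, unfold case_prod_beta)
    fix d
    show "(\<Sum>i<N. - 2 * (fst d \<bullet> ((mat 1 - \<Psi> ** matrix_inv (transpose \<Phi> ** \<Psi>) ** transpose \<Phi>)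
          ** transpose (C i) ** outer (e i) (z (t i)) ** matrix_inv (transpose \<Phi> ** \<Psi>)))
      + fst (snd d) \<bullet> (2 *\<^sub>R (\<Phi> ** matrix_inv (transpose \<Psi> ** \<Phi>) ** outer (z (t i)) (e i)
          ** C i ** \<Phi> ** matrix_inv (transpose \<Psi> ** \<Phi>)) - outer x0 (lam i (t 0)))
      - integral {t 0..t i} (\<lambda>s. lam i s \<bullet> rom_rhs (fst (snd (snd d))) (fst (snd (snd (snd d))))
          (snd (snd (snd (snd d)))) (z s) (u s)))
      = fst d \<bullet> (- 2 *\<^sub>R (\<Sum>i<N. (mat 1 - \<Psi> ** matrix_inv (transpose \<Phi> ** \<Psi>) ** transpose \<Phi>)
            ** transpose (C i) ** outer (e i) (z (t i)) ** matrix_inv (transpose \<Phi> ** \<Psi>)))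
      + fst (snd d) \<bullet> (\<Sum>i<N. 2 *\<^sub>R (\<Phi> ** matrix_inv (transpose \<Psi> ** \<Phi>) ** outer (z (t i)) (e i)
            ** C i ** \<Phi> ** matrix_inv (transpose \<Psi> ** \<Phi>)) - outer x0 (lam i (t 0)))
      + fst (snd (snd d)) \<bullet> (- (\<Sum>i<N. integral {t 0..t i} (\<lambda>s. outer (lam i s) (z s))))
      + fst (snd (snd (snd d))) \<bullet> (- (\<Sum>i<N. integral {t 0..t i} (\<lambda>s. tensor_outer (lam i s) (z s))))
      + snd (snd (snd (snd d))) \<bullet> (- (\<Sum>i<N. integral {t 0..t i} (\<lambda>s. outer (lam i s) (u s))))"
      by (simp only: inner_scaleR_right inner_minus_right inner_sum_right sum_distrib_left
          sum_negf[symmetric] sum.distrib[symmetric]) (rule sum.cong[OF refl], simp add: int)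
  qed
qed

theorem proposition2p1:
  fixes N :: nat and t :: "nat \<Rightarrow> real"
    and x0 :: "real^'n" and y :: "nat \<Rightarrow> real^'p"
    and u :: "real \<Rightarrow> real^'m" and h :: "real^'n \<Rightarrow> real^'p"
    and \<Phi> \<Psi> :: "real^'r^'n"
    and A :: "real^'r^'r" and H :: "real^'r^'r^'r" and B :: "real^'m^'r"
    and z :: "real \<Rightarrow> real^'r"
    and e :: "nat \<Rightarrow> real^'p" and C :: "nat \<Rightarrow> real^'n^'p"
  assumes "CARD('r) \<le> CARD('n)"
    and "0 < N" and "strict_mono_on {..<N} t"
    and "continuous_on {t 0..t (N - 1)} u"
    and "\<forall>x. h differentiable (at x)"
    and "continuous_on UNIV (\<lambda>x. jacobian h (at x))"
    and "invertible (transpose \<Psi> ** \<Phi>)"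
    and "rom_solution t N x0 u \<Psi> A H B z"
    and "e = output_error t y h \<Phi> \<Psi> z"
    and "C = output_jacobian t h \<Phi> \<Psi> z"
  shows "(\<forall>\<^sub>F (\<Psi>', A', H', B') in nhds (\<Psi>, A, H, B). \<exists>w. rom_solution t N x0 u \<Psi>' A' H' B' w)
    \<and> (\<exists>lam. adjoint_solution t N y u h \<Phi> \<Psi> A H B z lam)
    \<and> (\<forall>lam. adjoint_solution t N y u h \<Phi> \<Psi> A H B z lam \<longrightarrow>
        (\<forall>F\<in>{reduced_lagrangian t N x0 y u h lam, reduced_cost t N x0 y u h}.
          GDERIV (\<lambda>X. F X \<Psi> A H B) \<Phi> :>
            - 2 *\<^sub>R (\<Sum>i<N. (mat 1 - \<Psi> ** matrix_inv (transpose \<Phi> ** \<Psi>) ** transpose \<Phi>)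
                ** transpose (C i) ** outer (e i) (z (t i)) ** matrix_inv (transpose \<Phi> ** \<Psi>))
        \<and> GDERIV (\<lambda>X. F \<Phi> X A H B) \<Psi> :>
            (\<Sum>i<N. 2 *\<^sub>R (\<Phi> ** matrix_inv (transpose \<Psi> ** \<Phi>) ** outer (z (t i)) (e i)
                ** C i ** \<Phi> ** matrix_inv (transpose \<Psi> ** \<Phi>))
              - outer x0 (lam i (t 0)))
        \<and> GDERIV (\<lambda>X. F \<Phi> \<Psi> X H B) A :>
            - (\<Sum>i<N. integral {t 0..t i} (\<lambda>s. outer (lam i s) (z s)))
        \<and> GDERIV (\<lambda>X. F \<Phi> \<Psi> A X B) H :>
            - (\<Sum>i<N. integral {t 0..t i} (\<lambda>s. tensor_outer (lam i s) (z s)))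
        \<and> GDERIV (\<lambda>X. F \<Phi> \<Psi> A H X) B :>
            - (\<Sum>i<N. integral {t 0..t i} (\<lambda>s. outer (lam i s) (u s)))))"
proof -
  have mono: "t 0 \<le> t i \<and> t i \<le> t (N - 1)" if "i < N" for i
    using strict_mono_on_leD[OF assms(3), of 0 i] strict_mono_on_leD[OF assms(3), of i "N - 1"] that
    by auto
  then have t: "t 0 \<le> t (N - 1)" and ti: "\<And>i. i < N \<Longrightarrow> t i \<in> {t 0..t (N - 1)}"
    using \<open>0 < N\<close> by auto
  note u = assms(4) and inv = assms(7) and z = assms(8) and e = assms(9) and C = assms(10)
  have h: "\<And>x. h differentiable (at x)" using assms(5) by blast
  have ex: "\<forall>\<^sub>F (\<Psi>', A', H', B') in nhds (\<Psi>, A, H, B). \<exists>w. rom_solution t N x0 u \<Psi>' A' H' B' w"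
    by (rule eventually_rom_solution_exists[OF t u z])
  \<comment> \<open>The multipliers are decoupled: each one solves its own terminal value problem,
    on a single point when \<open>i = 0\<close>.\<close>
  have "\<exists>lam. rom_adjoint (t 0) (t i) A H B u z lam \<and> lam (t i) =
      2 *\<^sub>R ((matrix_inv (transpose \<Phi> ** \<Psi>) ** transpose \<Phi>
        ** transpose (output_jacobian t h \<Phi> \<Psi> z i)) *v output_error t y h \<Phi> \<Psi> z i)"
    if i: "i < N" for i
    by (rule rom_adjoint_exists[OF _ continuous_on_subset[OF rom_solution_continuous_on[OF z]]])
      (use ti[OF i] in auto)
  then obtain lam where "\<And>i. i < N \<Longrightarrow> rom_adjoint (t 0) (t i) A H B u z (lam i) \<and> lam i (t i) =
      2 *\<^sub>R ((matrix_inv (transpose \<Phi> ** \<Psi>) ** transpose \<Phi>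
        ** transpose (output_jacobian t h \<Phi> \<Psi> z i)) *v output_error t y h \<Phi> \<Psi> z i)"
    by metis
  then have adjoint: "adjoint_solution t N y u h \<Phi> \<Psi> A H B z lam"
    unfolding adjoint_solution_def rom_adjoint_def by blast
  \<comment> \<open>Differentiating the Lagrangian needs its equality with the cost on a whole
    neighbourhood. That is where solvability for nearby parameters enters, pulled back along
    \<open>snd\<close> because \<Phi> is absent from the dynamics.\<close>
  have near: "\<forall>\<^sub>F p in nhds (\<Phi>, \<Psi>, A, H, B).
      (\<lambda>(\<Phi>', \<Psi>', A', H', B'). reduced_cost t N x0 y u h \<Phi>' \<Psi>' A' H' B') p
      = (\<lambda>(\<Phi>', \<Psi>', A', H', B'). reduced_lagrangian t N x0 y u h lam \<Phi>' \<Psi>' A' H' B') p" for lam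
  proof -
    have "filterlim snd (nhds (\<Psi>, A, H, B)) (nhds (\<Phi>, \<Psi>, A, H, B))"
      using tendsto_snd[OF filterlim_ident] by fastforce
    from eventually_compose_filterlim[OF ex this] show ?thesis
      by eventually_elim (auto intro!: reduced_lagrangian_eq_reduced_cost[OF ti, symmetric])
  qed
  have deriv: "((\<lambda>(\<Phi>', \<Psi>', A', H', B'). F \<Phi>' \<Psi>' A' H' B') has_derivative
      (\<lambda>(d\<Phi>, d\<Psi>, dA, dH, dB).
        d\<Phi> \<bullet> (- 2 *\<^sub>R (\<Sum>i<N. (mat 1 - \<Psi> ** matrix_inv (transpose \<Phi> ** \<Psi>) ** transpose \<Phi>)
            ** transpose (C i) ** outer (e i) (z (t i)) ** matrix_inv (transpose \<Phi> ** \<Psi>)))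
      + d\<Psi> \<bullet> (\<Sum>i<N. 2 *\<^sub>R (\<Phi> ** matrix_inv (transpose \<Psi> ** \<Phi>) ** outer (z (t i)) (e i)
            ** C i ** \<Phi> ** matrix_inv (transpose \<Psi> ** \<Phi>)) - outer x0 (lam i (t 0)))
      + dA \<bullet> (- (\<Sum>i<N. integral {t 0..t i} (\<lambda>s. outer (lam i s) (z s))))
      + dH \<bullet> (- (\<Sum>i<N. integral {t 0..t i} (\<lambda>s. tensor_outer (lam i s) (z s))))
      + dB \<bullet> (- (\<Sum>i<N. integral {t 0..t i} (\<lambda>s. outer (lam i s) (u s)))))) (at (\<Phi>, \<Psi>, A, H, B))"
    if lam: "adjoint_solution t N y u h \<Phi> \<Psi> A H B z lam"
      and F: "F \<in> {reduced_lagrangian t N x0 y u h lam, reduced_cost t N x0 y u h}" for lam F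
  proof -
    note cost = reduced_cost_has_derivative[OF t ti u h inv z lam, folded e C]
    \<comment> \<open>Transferring the derivative takes equality on a punctured neighbourhood and,
      separately, at the base point.\<close>
    from near[of lam] have "\<forall>\<^sub>F p in at (\<Phi>, \<Psi>, A, H, B).
      (\<lambda>(\<Phi>', \<Psi>', A', H', B'). reduced_cost t N x0 y u h \<Phi>' \<Psi>' A' H' B') p
      = (\<lambda>(\<Phi>', \<Psi>', A', H', B'). reduced_lagrangian t N x0 y u h lam \<Phi>' \<Psi>' A' H' B') p"
      "(\<lambda>(\<Phi>', \<Psi>', A', H', B'). reduced_cost t N x0 y u h \<Phi>' \<Psi>' A' H' B') (\<Phi>, \<Psi>, A, H, B)
      = (\<lambda>(\<Phi>', \<Psi>', A', H', B'). reduced_lagrangian t N x0 y u h lam \<Phi>' \<Psi>' A' H' B') (\<Phi>, \<Psi>, A, H, B)"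
      unfolding eventually_nhds_conv_at by blast+
    note lagrangian = has_derivative_transform_eventually[OF cost this UNIV_I]
    from F consider "F = reduced_lagrangian t N x0 y u h lam" | "F = reduced_cost t N x0 y u h"
      by blast
    then show ?thesis
    proof cases
      case 1
      show ?thesis unfolding 1 by (rule lagrangian)
    next
      case 2
      show ?thesis unfolding 2 by (rule cost)
    qed
  qed
  show ?thesis
    by (intro conjI exI[of _ lam] allI impI ballI ex adjoint partial_gradients[OF deriv])
qed

end
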